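(* There is an absolute constant $c>0$ such that the following holds. Let $n\ge1$, $k\ge2$, and let $\nu$ be a sub-distribution on $[k]$. Let $\Pi$ be a deterministic $[c_1,\ldots,c_k]$-bounded $k$-party protocol which solves unique set-disjointness under input distribution $\mathcal{D}_\nu$ with error at most $2\%$. Then $\sum_{i\in[k]} c_i/\nu(i)\ge c\,n$ (with conventions $0/0=0$, $a/0=+\infty$ for $a>0$).
   Context: A sub-distribution $\nu$ on $[k]$ satisfies $\nu(i)\ge0$ and $\sum_i\nu(i)\le1$. Inputs are $X=(X_1,\ldots,X_k)\in(\{0,1\}^n)^k$; $X^j=(X_1(j),\ldots,X_k(j))$; $\mathcal{F}_0=\{X:\forall j,|X^j|\le1\}$, $\mathcal{F}_1=\{X:\exists j,|X^j|=k,\forall j'\ne j,|X^{j'}|\le1\}$, correct output $b$ on $\mathcal{F}_b$. $\mathcal{D}^0_\nu$: independently for each $j\in[n]$, with probability $\nu(i)$ (for each $i$) let $X_i(j)$ be a uniform bit and $X_{i'}(j)=0$ for $i'\ne i$, and with probability $1-\sum_i\nu(i)$ set $X^j=0^k$. $\mathcal{D}^1_\nu$: sample $X\sim\mathcal{D}^0_\nu$ and a uniform $j^*\in[n]$ and set $X^{j^*}=1^k$. $\mathcal{D}_\nu$: uniform bit $b$, then $X\sim\mathcal{D}^b_\nu$. Protocols are in the blackboard model; $[c_1,\ldots,c_k]$-bounded means player $i$ writes at most $c_i$ bits in every transcript; error under $\mathcal{D}_\nu$ is the probability the output differs from $b$. *)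

theory Defs
  imports "HOL-Probability.Probability"
begin

text \<open>Players are indexed by 0..<k, coordinates by 0..<n.
  An input X :: nat => nat => bool, where X i j is the j-th bit of player i's string X_i.\<close>

type_synonym input = "nat \<Rightarrow> nat \<Rightarrow> bool"

text \<open>Deterministic blackboard protocols, written bit by bit.
  A node Node i f p0 p1: player i writes the bit f X_i on the board (which may depend on the
  board content so far, i.e. on the position in the tree, and on player i's own input only),
  and the protocol continues in p0 or p1. A leaf carries the output.\<close>

datatype protocol = Leaf bool | Node nat "(nat \<Rightarrow> bool) \<Rightarrow> bool" protocol protocol

fun run :: "protocol \<Rightarrow> input \<Rightarrow> bool" where
  "run (Leaf b) X = b"
| "run (Node i f p0 p1) X = (if f (X i) then run p1 X else run p0 X)"

fun bits_of :: "nat \<Rightarrow> protocol \<Rightarrow> input \<Rightarrow> nat" where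
  "bits_of i (Leaf b) X = 0"
| "bits_of i (Node i' f p0 p1) X =
     (if i' = i then 1 else 0) + (if f (X i') then bits_of i p1 X else bits_of i p0 X)"

fun speakers :: "protocol \<Rightarrow> nat set" where
  "speakers (Leaf b) = {}"
| "speakers (Node i f p0 p1) = insert i (speakers p0 \<union> speakers p1)"

definition bounded_protocol :: "nat \<Rightarrow> (nat \<Rightarrow> nat) \<Rightarrow> protocol \<Rightarrow> bool" where
  "bounded_protocol k c P \<longleftrightarrow> speakers P \<subseteq> {..<k} \<and> (\<forall>X. \<forall>i<k. bits_of i P X \<le> c i)"

definition sub_distribution :: "nat \<Rightarrow> (nat \<Rightarrow> real) \<Rightarrow> bool" where
  "sub_distribution k \<nu> \<longleftrightarrow> (\<forall>i<k. \<nu> i \<ge> 0) \<and> (\<Sum>i<k. \<nu> i) \<le> 1"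

definition choice_pmf :: "nat \<Rightarrow> (nat \<Rightarrow> real) \<Rightarrow> nat option pmf" where
  "choice_pmf k \<nu> = embed_pmf (\<lambda>w. case w of None \<Rightarrow> 1 - (\<Sum>i<k. \<nu> i)
                                         | Some i \<Rightarrow> (if i < k then \<nu> i else 0))"

definition column_pmf :: "nat \<Rightarrow> (nat \<Rightarrow> real) \<Rightarrow> (nat \<Rightarrow> bool) pmf" where
  "column_pmf k \<nu> = do {
     w \<leftarrow> choice_pmf k \<nu>;
     b \<leftarrow> bernoulli_pmf (1/2);
     return_pmf (\<lambda>i'. case w of None \<Rightarrow> False | Some i \<Rightarrow> (i' = i \<and> b)) }"

definition D0 :: "nat \<Rightarrow> nat \<Rightarrow> (nat \<Rightarrow> real) \<Rightarrow> input pmf" where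
  "D0 n k \<nu> = map_pmf (\<lambda>Y i j. Y j i) (Pi_pmf {..<n} (\<lambda>_. False) (\<lambda>_. column_pmf k \<nu>))"

definition D1 :: "nat \<Rightarrow> nat \<Rightarrow> (nat \<Rightarrow> real) \<Rightarrow> input pmf" where
  "D1 n k \<nu> = do {
     X \<leftarrow> D0 n k \<nu>;
     jstar \<leftarrow> pmf_of_set {..<n};
     return_pmf (\<lambda>i j. if j = jstar then i < k else X i j) }"

definition D :: "nat \<Rightarrow> nat \<Rightarrow> (nat \<Rightarrow> real) \<Rightarrow> (bool \<times> input) pmf" where
  "D n k \<nu> = do {
     b \<leftarrow> bernoulli_pmf (1/2);
     X \<leftarrow> (if b then D1 n k \<nu> else D0 n k \<nu>);
     return_pmf (b, X) }"

definition error :: "nat \<Rightarrow> nat \<Rightarrow> (nat \<Rightarrow> real) \<Rightarrow> protocol \<Rightarrow> real" where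
  "error n k \<nu> P = measure_pmf.prob (D n k \<nu>) {(b, X). run P X \<noteq> b}"

definition ratio :: "nat \<Rightarrow> real \<Rightarrow> ennreal" where
  "ratio a v = (if v = 0 then (if a = 0 then 0 else \<infinity>) else ennreal (real a / v))"

end

theory Submission
  imports Defs
begin

text \<open>Reveal which player owns each column. Given these choices \<open>W\<close> the inputs of the players are
  independent, each uniform on the cube over the columns the player owns, so every leaf of the protocol
  has a product probability. By the level-one inequality, \<open>c i\<close> bits of player \<open>i\<close> shift the bits in
  his columns by a total of \<open>O(c i)\<close> in squared bias; as \<open>j\<close> is owned by \<open>i\<close> with probability
  \<open>\<nu> i\<close>, for an average column the distances between the transcripts on a zero column and on the
  unit column of player \<open>i\<close>, summed over \<open>i\<close>, are \<open>O(\<Sum>i. c i / \<nu> i) / n\<close>. For product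
  weights this sum dominates, up to a constant independent of \<open>k\<close>, the squared Hellinger distance
  between the transcripts on an all-zero and an all-one column (an argument going back to Jayram).
  A protocol of small error must separate these two.\<close>

subsection \<open>Hellinger distances between product weights\<close>

text \<open>Up to scaling, the expected squared norm of \<open>\<Sum>q<m. (\<psi> q - z)\<close>, where \<open>\<psi> q\<close> has \<open>y i\<close>
  in place of \<open>x i\<close> on the \<open>q\<close>-th block of a uniformly random partition of the players into \<open>m\<close> blocks.\<close>

lemma product_quadratic_form_nonneg:
  fixes x y :: "nat \<Rightarrow> real"
  shows "0 \<le> real m * (\<Prod>i<k. (real m - 1) * (x i)\<^sup>2 + (y i)\<^sup>2)
      + real m * (real m - 1) * (\<Prod>i<k. (real m - 2) * (x i)\<^sup>2 + 2 * (x i * y i))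
      - 2 * (real m)\<^sup>2 * (\<Prod>i<k. (real m - 1) * (x i)\<^sup>2 + x i * y i)
      + (real m)\<^sup>2 * (\<Prod>i<k. real m * (x i)\<^sup>2)"
proof -
  \<comment> \<open>Each \<open>\<phi>\<close> assigns the players to \<open>m\<close> blocks.
    Summing over all assignments without normalizing keeps every term a plain product over players,
    by \<open>fact\<close>.\<close>
  define \<Phi> where "\<Phi> = PiE {..<k} (\<lambda>_. {..<m})"
  define \<psi> where "\<psi> q \<phi> = (\<Prod>i<k. if \<phi> i = q then y i else x i)" for q :: nat and \<phi> :: "nat \<Rightarrow> nat"
  define z where "z = (\<Prod>i<k. x i)"
  have fact: "(\<Sum>\<phi>\<in>\<Phi>. \<Prod>i<k. h i (\<phi> i)) = (\<Prod>i<k. \<Sum>c<m. h i c)" for h :: "nat \<Rightarrow> nat \<Rightarrow> real"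
    unfolding \<Phi>_def by (subst prod_sum_PiE) auto
  have one: "(\<Sum>c<m. if c = q then u else v) = (real m - 1) * v + u" if "q < m" for q and u v :: real
  proof -
    have "(\<Sum>c<m. if c = q then u else v) = (\<Sum>c<m. v + (if c = q then u - v else 0))"
      by (intro sum.cong) auto
    also have "\<dots> = real m * v + (u - v)"
      using that by (simp add: sum.distrib)
    finally show ?thesis by (simp add: algebra_simps)
  qed
  have two: "(\<Sum>c<m. if c = q \<or> c = r then u else v) = (real m - 2) * v + 2 * u"
    if "q < m" "r < m" "q \<noteq> r" for q r and u v :: real
  proof -
    have "(\<Sum>c<m. if c = q \<or> c = r then u else v)
        = (\<Sum>c<m. v + (if c = q then u - v else 0) + (if c = r then u - v else 0))"
      using that by (intro sum.cong) auto
    also have "\<dots> = real m * v + (u - v) + (u - v)"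
      using that by (simp add: sum.distrib)
    finally show ?thesis by (simp add: algebra_simps)
  qed
  have s0: "(\<Sum>\<phi>\<in>\<Phi>. z * z) = (\<Prod>i<k. real m * (x i)\<^sup>2)"
    using fact[of "\<lambda>i _. (x i)\<^sup>2"]
    by (simp add: z_def prod.distrib[symmetric] power2_eq_square)
  have s1: "(\<Sum>\<phi>\<in>\<Phi>. z * \<psi> q \<phi>) = (\<Prod>i<k. (real m - 1) * (x i)\<^sup>2 + x i * y i)" if "q < m" for q
  proof -
    have "(\<Sum>\<phi>\<in>\<Phi>. z * \<psi> q \<phi>) = (\<Sum>\<phi>\<in>\<Phi>. \<Prod>i<k. if \<phi> i = q then x i * y i else (x i)\<^sup>2)"
      unfolding z_def \<psi>_def prod.distrib[symmetric]
      by (intro sum.cong prod.cong refl) (auto simp: power2_eq_square)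
    also have "\<dots> = (\<Prod>i<k. (real m - 1) * (x i)\<^sup>2 + x i * y i)"
      by (subst fact[of "\<lambda>i c. if c = q then x i * y i else (x i)\<^sup>2"]) (simp only: one[OF that])
    finally show ?thesis .
  qed
  have s2: "(\<Sum>\<phi>\<in>\<Phi>. \<psi> q \<phi> * \<psi> q \<phi>) = (\<Prod>i<k. (real m - 1) * (x i)\<^sup>2 + (y i)\<^sup>2)" if "q < m" for q
  proof -
    have "(\<Sum>\<phi>\<in>\<Phi>. \<psi> q \<phi> * \<psi> q \<phi>) = (\<Sum>\<phi>\<in>\<Phi>. \<Prod>i<k. if \<phi> i = q then (y i)\<^sup>2 else (x i)\<^sup>2)"
      unfolding \<psi>_def prod.distrib[symmetric]
      by (intro sum.cong prod.cong refl) (auto simp: power2_eq_square)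
    also have "\<dots> = (\<Prod>i<k. (real m - 1) * (x i)\<^sup>2 + (y i)\<^sup>2)"
      by (subst fact[of "\<lambda>i c. if c = q then (y i)\<^sup>2 else (x i)\<^sup>2"]) (simp only: one[OF that])
    finally show ?thesis .
  qed
  \<comment> \<open>A player lies in at most one of two distinct blocks, so no factor
    \<open>y i * y i\<close> arises: two of the \<open>m\<close> choices give
    \<open>x i * y i\<close>, the others the square of \<open>x i\<close>.\<close>
  have s3: "(\<Sum>\<phi>\<in>\<Phi>. \<psi> q \<phi> * \<psi> r \<phi>) = (\<Prod>i<k. (real m - 2) * (x i)\<^sup>2 + 2 * (x i * y i))"
    if "q < m" "r < m" "q \<noteq> r" for q r
  proof -
    have "(\<Sum>\<phi>\<in>\<Phi>. \<psi> q \<phi> * \<psi> r \<phi>)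
        = (\<Sum>\<phi>\<in>\<Phi>. \<Prod>i<k. if \<phi> i = q \<or> \<phi> i = r then x i * y i else (x i)\<^sup>2)"
      unfolding \<psi>_def prod.distrib[symmetric]
      using that by (intro sum.cong prod.cong refl) (auto simp: power2_eq_square)
    also have "\<dots> = (\<Prod>i<k. (real m - 2) * (x i)\<^sup>2 + 2 * (x i * y i))"
      by (subst fact[of "\<lambda>i c. if c = q \<or> c = r then x i * y i else (x i)\<^sup>2"]) (simp only: two[OF that])
    finally show ?thesis .
  qed
  have s23: "(\<Sum>q<m. \<Sum>r<m. \<Sum>\<phi>\<in>\<Phi>. \<psi> q \<phi> * \<psi> r \<phi>)
     = real m * (\<Prod>i<k. (real m - 1) * (x i)\<^sup>2 + (y i)\<^sup>2)
      + real m * (real m - 1) * (\<Prod>i<k. (real m - 2) * (x i)\<^sup>2 + 2 * (x i * y i))" (is "_ = _ * ?a + _ * _ * ?b")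
  proof -
    have "(\<Sum>q<m. \<Sum>r<m. \<Sum>\<phi>\<in>\<Phi>. \<psi> q \<phi> * \<psi> r \<phi>) = (\<Sum>q<m. \<Sum>r<m. if r = q then ?a else ?b)"
      by (intro sum.cong refl) (auto simp: s2 s3)
    also have "\<dots> = (\<Sum>q<m. (real m - 1) * ?b + ?a)"
      by (intro sum.cong refl one) auto
    finally show ?thesis by (simp add: algebra_simps)
  qed
  have "0 \<le> (\<Sum>\<phi>\<in>\<Phi>. ((\<Sum>q<m. \<psi> q \<phi>) - real m * z)\<^sup>2)"
    by (intro sum_nonneg) auto
  also have "\<dots> = (\<Sum>\<phi>\<in>\<Phi>. (\<Sum>q<m. \<Sum>r<m. \<psi> q \<phi> * \<psi> r \<phi>) - 2 * real m * (\<Sum>q<m. z * \<psi> q \<phi>)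
       + (real m)\<^sup>2 * (z * z))"
    by (intro sum.cong refl)
      (simp add: power2_eq_square algebra_simps sum_product sum_distrib_left)
  also have "\<dots> = (\<Sum>q<m. \<Sum>r<m. \<Sum>\<phi>\<in>\<Phi>. \<psi> q \<phi> * \<psi> r \<phi>) - 2 * real m * (\<Sum>q<m. \<Sum>\<phi>\<in>\<Phi>. z * \<psi> q \<phi>)
       + (real m)\<^sup>2 * (\<Sum>\<phi>\<in>\<Phi>. z * z)"
  proof -
    have "(\<Sum>\<phi>\<in>\<Phi>. \<Sum>q<m. \<Sum>r<m. \<psi> q \<phi> * \<psi> r \<phi>) = (\<Sum>q<m. \<Sum>r<m. \<Sum>\<phi>\<in>\<Phi>. \<psi> q \<phi> * \<psi> r \<phi>)"
      by (subst sum.swap, intro sum.cong refl, subst sum.swap, rule refl)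
    moreover have "(\<Sum>\<phi>\<in>\<Phi>. \<Sum>q<m. z * \<psi> q \<phi>) = (\<Sum>q<m. \<Sum>\<phi>\<in>\<Phi>. z * \<psi> q \<phi>)"
      by (rule sum.swap)
    ultimately show ?thesis
      by (simp add: sum.distrib sum_subtractf sum_distrib_left[symmetric] del: sum_constant)
  qed
  also have "(\<Sum>q<m. \<Sum>\<phi>\<in>\<Phi>. z * \<psi> q \<phi>) = real m * (\<Prod>i<k. (real m - 1) * (x i)\<^sup>2 + x i * y i)"
    by (simp add: s1)
  finally show ?thesis unfolding s23 s0 by (simp add: power2_eq_square algebra_simps)
qed

text \<open>\<open>G p\<close> is the expected Hellinger affinity between the all-\<open>a\<close> weights and those in which each
  factor is switched to \<open>b\<close> with probability \<open>p\<close>.\<close>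

lemma interpolated_affinity_halving:
  fixes a b :: "nat \<Rightarrow> 'l \<Rightarrow> real" and I :: "'l set" and k :: nat
  defines "G \<equiv> \<lambda>p. \<Sum>l\<in>I. \<Prod>i<k. (1 - p) * a i l + p * sqrt (a i l * b i l)"
  assumes nn: "\<And>i l. a i l \<ge> 0" "\<And>i l. b i l \<ge> 0"
    and norm: "\<And>p. 0 \<le> p \<Longrightarrow> p \<le> 1 \<Longrightarrow> (\<Sum>l\<in>I. \<Prod>i<k. (1 - p) * a i l + p * b i l) = 1"
    and m: "m \<ge> 2"
  shows "(real m - 1) * (1 - G (2 / m)) \<le> 2 * m * (1 - G (1 / m))"
proof -
  have m0: "real m > 0" using m by simp
  have *: "0 \<le> real m * (\<Prod>i<k. (1 - 1/m) * a i l + (1/m) * b i l)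
      + real m * (real m - 1) * (\<Prod>i<k. (1 - 2/m) * a i l + (2/m) * sqrt (a i l * b i l))
      - 2 * (real m)\<^sup>2 * (\<Prod>i<k. (1 - 1/m) * a i l + (1/m) * sqrt (a i l * b i l))
      + (real m)\<^sup>2 * (\<Prod>i<k. (1 - 0) * a i l + 0 * b i l)" (is "0 \<le> ?R") for l
  proof -
    have scale: "(\<Prod>i<k. m * h i) = real m ^ k * (\<Prod>i<k. h i)" for h :: "nat \<Rightarrow> real"
      by (simp add: prod.distrib)
    \<comment> \<open>With square roots for \<open>x\<close> and \<open>y\<close>, taking one factor
      \<open>m\<close> out per player turns block counts into switching probabilities
      \<open>1/m\<close> and \<open>2/m\<close>.\<close>
    have e: "(real m - 1) * (sqrt (a i l))\<^sup>2 + (sqrt (b i l))\<^sup>2 = m * ((1 - 1/m) * a i l + (1/m) * b i l)"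
      "(real m - 2) * (sqrt (a i l))\<^sup>2 + 2 * (sqrt (a i l) * sqrt (b i l))
        = m * ((1 - 2/m) * a i l + (2/m) * sqrt (a i l * b i l))"
      "(real m - 1) * (sqrt (a i l))\<^sup>2 + sqrt (a i l) * sqrt (b i l)
        = m * ((1 - 1/m) * a i l + (1/m) * sqrt (a i l * b i l))"
      "real m * (sqrt (a i l))\<^sup>2 = m * ((1 - 0) * a i l + 0 * b i l)" for i
      using m0 nn by (simp_all add: real_sqrt_mult field_simps)
    have factor: "m * (K * A) + real m * (real m - 1) * (K * B) - 2 * (real m)\<^sup>2 * (K * C) + (real m)\<^sup>2 * (K * D)
       = K * (m * A + real m * (real m - 1) * B - 2 * (real m)\<^sup>2 * C + (real m)\<^sup>2 * D)" for K A B C D :: real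
      by (simp add: algebra_simps)
    have "0 \<le> real m ^ k * ?R"
      using product_quadratic_form_nonneg[where m = m and k = k and x = "\<lambda>i. sqrt (a i l)" and y = "\<lambda>i. sqrt (b i l)"]
      unfolding e scale factor .
    then show ?thesis
      using zero_less_power[OF m0, of k] by (simp add: zero_le_mult_iff)
  qed
  have "0 \<le> (\<Sum>l\<in>I. real m * (\<Prod>i<k. (1 - 1/m) * a i l + (1/m) * b i l)
      + real m * (real m - 1) * (\<Prod>i<k. (1 - 2/m) * a i l + (2/m) * sqrt (a i l * b i l))
      - 2 * (real m)\<^sup>2 * (\<Prod>i<k. (1 - 1/m) * a i l + (1/m) * sqrt (a i l * b i l))
      + (real m)\<^sup>2 * (\<Prod>i<k. (1 - 0) * a i l + 0 * b i l))"
    by (intro sum_nonneg *)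
  also have "\<dots> = m * 1 + real m * (real m - 1) * G (2/m) - 2 * (real m)\<^sup>2 * G (1/m) + (real m)\<^sup>2 * 1"
    unfolding sum.distrib sum_subtractf sum_distrib_left[symmetric]
    using norm[of "1/m"] norm[of 0] m by (simp add: G_def)
  finally have "0 \<le> m * (2 * m * (1 - G (1 / m)) - (real m - 1) * (1 - G (2 / m)))"
    by (simp add: power2_eq_square algebra_simps)
  then show ?thesis using m0 by (simp add: zero_le_mult_iff)
qed

text \<open>Each factor is \<open>sqrt a * ((1 - p) * sqrt a + p * sqrt b)\<close>; AM-GM for the
  two products and convexity of the square finish. Summed over \<open>I\<close>, this gives
  \<open>G p \<le> 1\<close>, the sign needed to iterate the halving.\<close>

lemma prod_interpolated_affinity_le:
  fixes a b :: "nat \<Rightarrow> real"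
  assumes nn: "\<And>i. a i \<ge> 0" "\<And>i. b i \<ge> 0" and p: "0 \<le> p" "p \<le> 1"
  shows "(\<Prod>i<k. (1 - p) * a i + p * sqrt (a i * b i))
    \<le> ((\<Prod>i<k. (1 - 0) * a i + 0 * b i) + (\<Prod>i<k. (1 - p) * a i + p * b i)) / 2"
proof -
  define u where "u = (\<Prod>i<k. sqrt (a i))"
  define v where "v = (\<Prod>i<k. (1 - p) * sqrt (a i) + p * sqrt (b i))"
  have "(\<Prod>i<k. (1 - p) * a i + p * sqrt (a i * b i)) = u * v"
    unfolding u_def v_def prod.distrib[symmetric]
    using nn by (intro prod.cong refl) (simp add: real_sqrt_mult algebra_simps)
  also have "\<dots> \<le> (u\<^sup>2 + v\<^sup>2) / 2"
    using sum_squares_bound[of u v] by simp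
  also have "u\<^sup>2 = (\<Prod>i<k. (1 - 0) * a i + 0 * b i)"
    using nn by (simp add: u_def prod_power_distrib)
  also have "v\<^sup>2 \<le> (\<Prod>i<k. (1 - p) * a i + p * b i)"
    unfolding v_def prod_power_distrib
  proof (intro prod_mono conjI)
    fix i
    have "0 \<le> p * (1 - p) * (sqrt (a i) - sqrt (b i))\<^sup>2"
      using p by simp
    also have "\<dots> = (1 - p) * (sqrt (a i))\<^sup>2 + p * (sqrt (b i))\<^sup>2 - ((1 - p) * sqrt (a i) + p * sqrt (b i))\<^sup>2"
      by (simp add: power2_eq_square algebra_simps)
    finally show "((1 - p) * sqrt (a i) + p * sqrt (b i))\<^sup>2 \<le> (1 - p) * a i + p * b i"
      using nn by simp
  qed simp
  finally show ?thesis by simp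
qed

text \<open>With \<open>N = 2 ^ Suc t\<close> the prefactor is \<open>4 * (N - 1)\<close>, and
  halving at \<open>m = 2 * N\<close> carries the bound from \<open>N\<close> to
  \<open>2 * N\<close>. Its linear growth in \<open>N\<close> is what leaves a difference quotient
  of \<open>G\<close> at 0 in the limit.\<close>

lemma interpolated_affinity_bound:
  fixes a b :: "nat \<Rightarrow> 'l \<Rightarrow> real" and I :: "'l set" and k :: nat
  defines "G \<equiv> \<lambda>p. \<Sum>l\<in>I. \<Prod>i<k. (1 - p) * a i l + p * sqrt (a i l * b i l)"
  assumes nn: "\<And>i l. a i l \<ge> 0" "\<And>i l. b i l \<ge> 0"
    and norm: "\<And>p. 0 \<le> p \<Longrightarrow> p \<le> 1 \<Longrightarrow> (\<Sum>l\<in>I. \<Prod>i<k. (1 - p) * a i l + p * b i l) = 1"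
  shows "1 - G 1 \<le> 4 * 2 ^ Suc t * (1 - (1/2) ^ Suc t) * (1 - G ((1/2) ^ Suc t))"
proof -
  have halve: "(real m - 1) * (1 - G (2 / m)) \<le> 2 * m * (1 - G (1 / m))" if "m \<ge> 2" for m
    unfolding G_def by (rule interpolated_affinity_halving[OF nn norm that])
  show ?thesis
  proof (induction t)
    case 0
    show ?case using halve[of 2] by simp
  next
    case (Suc t)
    define M where "M = (2::real) ^ t"
    have M: "M \<ge> 1" by (simp add: M_def)
    have h: "(4 * M - 1) * (1 - G (1 / (2 * M))) \<le> 8 * M * (1 - G (1 / (4 * M)))"
      using halve[of "4 * 2 ^ t"] M by (simp add: M_def)
    have "4 * 2 ^ Suc t * (1 - (1/2) ^ Suc t) * (1 - G ((1/2) ^ Suc t))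
       = (8 * M - 4) * (1 - G (1 / (2 * M)))"
      using M by (simp add: M_def power_one_over field_simps)
    also have "\<dots> \<le> (8 * M - 4) * (8 * M / (4 * M - 1) * (1 - G (1 / (4 * M))))"
      using h M by (intro mult_left_mono) (auto simp: field_simps)
    also have "\<dots> = (8 * M - 4) * (8 * M) / (4 * M - 1) * (1 - G (1 / (4 * M)))"
      by simp
    also have "\<dots> \<le> (4 * (4 * M - 1)) * (1 - G (1 / (4 * M)))"
    proof (rule mult_right_mono)
      \<comment> \<open>After clearing the denominator and dividing by 4 the two sides differ by
        exactly 1.\<close>
      show "(8 * M - 4) * (8 * M) / (4 * M - 1) \<le> 4 * (4 * M - 1)"
        using M by (simp add: divide_le_eq) (simp add: algebra_simps)
      have "G (1 / (4 * M)) \<le> (\<Sum>l\<in>I. ((\<Prod>i<k. (1 - 0) * a i l + 0 * b i l)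
          + (\<Prod>i<k. (1 - 1/(4*M)) * a i l + (1/(4*M)) * b i l)) / 2)"
        unfolding G_def using M by (intro sum_mono prod_interpolated_affinity_le nn) auto
      then show "0 \<le> 1 - G (1 / (4 * M))"
        using norm[of 0] norm[of "1/(4*M)"] M by (simp add: sum_divide_distrib[symmetric] sum.distrib)
    qed
    also have "\<dots> = 4 * 2 ^ Suc (Suc t) * (1 - (1/2) ^ Suc (Suc t)) * (1 - G ((1/2) ^ Suc (Suc t)))"
      using M by (simp add: M_def power_one_over field_simps)
    finally show ?case by (rule order_trans[OF Suc])
  qed
qed

text \<open>Let \<open>t\<close> tend to infinity: only single switched factors contribute to the derivative of \<open>G\<close> at 0.\<close>

lemma interpolated_affinity_le_local:
  fixes a b :: "nat \<Rightarrow> 'l \<Rightarrow> real" and I :: "'l set" and k :: nat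
  assumes nn: "\<And>i l. a i l \<ge> 0" "\<And>i l. b i l \<ge> 0"
    and norm: "\<And>p. 0 \<le> p \<Longrightarrow> p \<le> 1 \<Longrightarrow> (\<Sum>l\<in>I. \<Prod>i<k. (1 - p) * a i l + p * b i l) = 1"
  shows "1 - (\<Sum>l\<in>I. \<Prod>i<k. sqrt (a i l * b i l))
    \<le> 2 * (\<Sum>l\<in>I. \<Sum>i<k. (sqrt (a i l) - sqrt (b i l))\<^sup>2 * (\<Prod>i'\<in>{..<k}-{i}. a i' l))"
    (is "_ \<le> 2 * ?D")
proof -
  define G where "G = (\<lambda>p. \<Sum>l\<in>I. \<Prod>i<k. (1 - p) * a i l + p * sqrt (a i l * b i l))"
  \<comment> \<open>The first summand sums to 1 for \<open>p\<close> in \<open>[0, 1]\<close>, so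
    \<open>f\<close> is \<open>1 - G\<close> there. Writing the 1 as this average makes
    \<open>f 0 = 0\<close> an identity and the derivative at 0 termwise a combination of squares
    \<open>(sqrt a - sqrt b)^2\<close>.\<close>
  define f where "f p = (\<Sum>l\<in>I. ((\<Prod>i<k. a i l) + (\<Prod>i<k. (1 - p) * a i l + p * b i l)) / 2
     - (\<Prod>i<k. (1 - p) * a i l + p * sqrt (a i l * b i l)))" for p :: real
  have f: "1 - G p = f p" if "0 \<le> p" "p \<le> 1" for p
    using norm[of p] norm[of 0] that
    by (simp add: f_def G_def sum_subtractf sum_divide_distrib[symmetric] sum.distrib)
  have f0: "f 0 = 0" by (simp add: f_def)
  have deriv: "(f has_field_derivative (\<Sum>l\<in>I. (0 + (\<Sum>i<k. (b i l - a i l) * (\<Prod>i'\<in>{..<k}-{i}. (1 - 0) * a i' l + 0 * b i' l))) / 2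
     - (\<Sum>i<k. (sqrt (a i l * b i l) - a i l) * (\<Prod>i'\<in>{..<k}-{i}. (1 - 0) * a i' l + 0 * sqrt (a i' l * b i' l))))) (at 0)"
    unfolding f_def
    by (intro DERIV_sum DERIV_diff DERIV_add DERIV_cdivide DERIV_const has_field_derivative_prod)
      (auto intro!: derivative_eq_intros)
  also have "(\<Sum>l\<in>I. (0 + (\<Sum>i<k. (b i l - a i l) * (\<Prod>i'\<in>{..<k}-{i}. (1 - 0) * a i' l + 0 * b i' l))) / 2
     - (\<Sum>i<k. (sqrt (a i l * b i l) - a i l) * (\<Prod>i'\<in>{..<k}-{i}. (1 - 0) * a i' l + 0 * sqrt (a i' l * b i' l)))) = ?D / 2"
  proof -
    have "(sqrt (a i l) - sqrt (b i l))\<^sup>2 = (b i l - a i l) - 2 * (sqrt (a i l * b i l) - a i l)" for i l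
      using nn by (simp add: power2_diff real_sqrt_mult)
    then have "(sqrt (a i l) - sqrt (b i l))\<^sup>2 * u = (b i l - a i l) * u - 2 * ((sqrt (a i l * b i l) - a i l) * u)" for i l u
      by (simp only: left_diff_distrib mult.assoc)
    then show ?thesis
      by (simp add: sum_divide_distrib sum_subtractf sum_distrib_left diff_divide_distrib)
  qed
  finally have lim: "((\<lambda>h. f h / h) \<longlongrightarrow> ?D / 2) (at 0)"
    by (simp add: DERIV_def f0)
  have "filterlim (\<lambda>t. (1/2) ^ Suc t :: real) (at 0) sequentially"
    unfolding filterlim_at by (auto intro!: filterlim_compose[OF _ filterlim_Suc] LIMSEQ_power_zero[of "1/2::real"] simp del: power_Suc)
  note lim' = filterlim_compose[OF lim this]
  have "(\<lambda>t. (1/2) ^ Suc t :: real) \<longlonglongrightarrow> 0"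
    by (intro LIMSEQ_Suc LIMSEQ_power_zero) auto
  \<comment> \<open>The factor \<open>2 ^ Suc t\<close> of the iterated bound is the division by
    \<open>p = (1/2) ^ Suc t\<close>, so the right side converges to
    \<open>4 * (?D / 2)\<close>.\<close>
  then have "(\<lambda>t. 4 * (1 - (1/2) ^ Suc t) * (f ((1/2) ^ Suc t) / (1/2) ^ Suc t)) \<longlonglongrightarrow> 4 * (1 - 0) * (?D / 2)"
    by (intro tendsto_mult tendsto_diff tendsto_const lim')
  moreover have "1 - G 1 \<le> 4 * (1 - (1/2) ^ Suc t) * (f ((1/2) ^ Suc t) / (1/2) ^ Suc t)" for t
  proof -
    have "1 - G 1 \<le> 4 * 2 ^ Suc t * (1 - (1/2) ^ Suc t) * (1 - G ((1/2) ^ Suc t))"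
      unfolding G_def by (rule interpolated_affinity_bound[OF nn norm])
    also have "1 - G ((1/2) ^ Suc t) = f ((1/2) ^ Suc t)"
      by (intro f power_le_one) auto
    finally show ?thesis
      by (simp add: power_one_over field_simps)
  qed
  ultimately have "1 - G 1 \<le> 4 * (1 - 0) * (?D / 2)"
    by (intro LIMSEQ_le_const) auto
  then show ?thesis by (simp add: G_def)
qed

text \<open>Multiply by \<open>(sqrt a + sqrt b)^2\<close>, which is at least \<open>a + b\<close>.
  This passes from Hellinger terms to the triangular discrimination, the form that squared biases
  control.\<close>

lemma sqrt_diff_square_le:
  fixes a b :: real
  assumes "a \<ge> 0" "b \<ge> 0"
  shows "(sqrt a - sqrt b)\<^sup>2 \<le> (b - a)\<^sup>2 / (a + b)"
proof (cases "a + b = 0")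
  case False
  then have pos: "a + b > 0" using assms by simp
  have "(sqrt a - sqrt b)\<^sup>2 * (a + b) \<le> (sqrt a - sqrt b)\<^sup>2 * (sqrt a + sqrt b)\<^sup>2"
    using assms by (intro mult_left_mono) (auto simp: power2_sum)
  also have "\<dots> = ((sqrt a)\<^sup>2 - (sqrt b)\<^sup>2)\<^sup>2"
    by (simp add: power2_eq_square algebra_simps)
  also have "\<dots> = (b - a)\<^sup>2"
    using assms by (simp add: power2_commute)
  finally show ?thesis using pos by (simp add: pos_le_divide_eq)
next
  case True
  then have "a = 0" "b = 0" using assms by linarith+
  then show ?thesis by simp
qed

text \<open>An event gap is bounded by squared Hellinger distance plus a constant loss. The loss
  \<open>1/4\<close> is total mass 2 times \<open>1/8\<close>; the factor 16 is the weight 4, times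
  2 from \<open>2 * (1 - affinity)\<close>, times 2 from the local bound.\<close>

lemma product_measures_event_gap:
  fixes a b :: "nat \<Rightarrow> 'l \<Rightarrow> real" and I Q :: "'l set" and k :: nat
  assumes nn: "\<And>i l. a i l \<ge> 0" "\<And>i l. b i l \<ge> 0"
    and norm: "\<And>p. 0 \<le> p \<Longrightarrow> p \<le> 1 \<Longrightarrow> (\<Sum>l\<in>I. \<Prod>i<k. (1 - p) * a i l + p * b i l) = 1"
    and Q: "finite I" "Q \<subseteq> I"
  shows "(\<Sum>l\<in>Q. \<Prod>i<k. b i l) - (\<Sum>l\<in>Q. \<Prod>i<k. a i l)
    \<le> 1/4 + 16 * (\<Sum>i<k. \<Sum>l\<in>I. (b i l - a i l)\<^sup>2 / (a i l + b i l) * (\<Prod>i'\<in>{..<k}-{i}. a i' l))"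
proof -
  define u where "u l = (\<Prod>i<k. a i l)" for l
  define v where "v l = (\<Prod>i<k. b i l)" for l
  have uv: "u l \<ge> 0" "v l \<ge> 0" for l
    using nn by (auto simp: u_def v_def intro: prod_nonneg)
  have su: "sum u I = 1" using norm[of 0] by (simp add: u_def)
  have sv: "sum v I = 1" using norm[of 1] by (simp add: v_def)
  have pw: "y - x \<le> 4 * (sqrt y - sqrt x)\<^sup>2 + (x + y) / 8" if "x \<ge> 0" "y \<ge> 0" for x y :: real
  proof -
    \<comment> \<open>AM-GM for \<open>(q - p) * (q + p)\<close>, with \<open>p^2 + q^2\<close>
      written as half the sum of the squares of \<open>q + p\<close> and
      \<open>q - p\<close>.\<close>
    have "0 \<le> (2 * (q - p) - (q + p) / 4)\<^sup>2 + (q - p)\<^sup>2 / 16" for p q :: real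
      by simp
    also have "(2 * (q - p) - (q + p) / 4)\<^sup>2 + (q - p)\<^sup>2 / 16 = 4 * (q - p)\<^sup>2 + (p\<^sup>2 + q\<^sup>2) / 8 - (q\<^sup>2 - p\<^sup>2)" for p q :: real
      by (simp add: power2_eq_square field_simps)
    finally have "0 \<le> 4 * (sqrt y - sqrt x)\<^sup>2 + ((sqrt x)\<^sup>2 + (sqrt y)\<^sup>2) / 8 - ((sqrt y)\<^sup>2 - (sqrt x)\<^sup>2)" .
    then show ?thesis using that by simp
  qed
  have "(\<Sum>l\<in>Q. v l) - (\<Sum>l\<in>Q. u l) \<le> (\<Sum>l\<in>Q. 4 * (sqrt (v l) - sqrt (u l))\<^sup>2 + (u l + v l) / 8)"
    unfolding sum_subtractf[symmetric] by (intro sum_mono pw uv)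
  also have "\<dots> \<le> (\<Sum>l\<in>I. 4 * (sqrt (v l) - sqrt (u l))\<^sup>2 + (u l + v l) / 8)"
    using Q uv by (intro sum_mono2) auto
  also have "\<dots> = (\<Sum>l\<in>I. (4 + 1/8) * v l + (4 + 1/8) * u l - 8 * sqrt (u l * v l))"
    using uv by (intro sum.cong refl) (simp add: power2_diff real_sqrt_mult field_simps)
  also have "\<dots> = 1/4 + 8 * (1 - (\<Sum>l\<in>I. sqrt (u l * v l)))"
    by (simp add: sum.distrib sum_subtractf sum_distrib_left[symmetric] sum_divide_distrib[symmetric] su sv)
  also have "(\<Sum>l\<in>I. sqrt (u l * v l)) = (\<Sum>l\<in>I. \<Prod>i<k. sqrt (a i l * b i l))"
  proof (rule sum.cong[OF refl])
    show "sqrt (u l * v l) = (\<Prod>i<k. sqrt (a i l * b i l))" for l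
      unfolding u_def v_def prod.distrib[symmetric] by (induction k) (simp_all add: real_sqrt_mult)
  qed
  also have "8 * (1 - (\<Sum>l\<in>I. \<Prod>i<k. sqrt (a i l * b i l)))
     \<le> 16 * (\<Sum>l\<in>I. \<Sum>i<k. (sqrt (a i l) - sqrt (b i l))\<^sup>2 * (\<Prod>i'\<in>{..<k}-{i}. a i' l))"
    using interpolated_affinity_le_local[OF nn norm] by simp
  also have "(\<Sum>l\<in>I. \<Sum>i<k. (sqrt (a i l) - sqrt (b i l))\<^sup>2 * (\<Prod>i'\<in>{..<k}-{i}. a i' l))
    \<le> (\<Sum>l\<in>I. \<Sum>i<k. (b i l - a i l)\<^sup>2 / (a i l + b i l) * (\<Prod>i'\<in>{..<k}-{i}. a i' l))"
    using nn by (intro sum_mono mult_right_mono sqrt_diff_square_le prod_nonneg) auto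
  also have "\<dots> = (\<Sum>i<k. \<Sum>l\<in>I. (b i l - a i l)\<^sup>2 / (a i l + b i l) * (\<Prod>i'\<in>{..<k}-{i}. a i' l))"
    by (rule sum.swap)
  finally show ?thesis by (simp add: u_def v_def)
qed

section \<open>Elementary exponential inequalities\<close>

lemma mult_exp_ge: "exp s * (1 + x - s) \<le> exp (x::real)"
proof -
  have "exp s * (1 + (x - s)) \<le> exp s * exp (x - s)"
    by (intro mult_left_mono exp_ge_add_one_self) auto
  then show ?thesis by (simp add: exp_diff add_diff_eq)
qed

text \<open>The quadratic Taylor lower bound for \<open>exp y\<close> is inverted to bound
  \<open>exp (- y)\<close>: the product of \<open>1 + y + y^2/2\<close> and
  \<open>1 - y + y^2/2\<close> is \<open>1 + y^4/4\<close>, so at least 1.\<close>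

lemma exp_plus_exp_minus_le:
  fixes x :: real
  assumes "\<bar>x\<bar> \<le> 1"
  shows "exp x + exp (- x) \<le> 2 * exp (x\<^sup>2)"
proof -
  have *: "exp y + exp (- y) \<le> 2 * exp (y\<^sup>2)" if y: "0 \<le> y" "y \<le> 1" for y :: real
  proof -
    have e: "1 + y + y\<^sup>2 / 2 \<le> exp y"
      using exp_lower_Taylor_quadratic[OF y(1)] by simp
    have p: "0 < 1 + y + y\<^sup>2 / 2" using y by (simp add: add_pos_nonneg)
    have "exp (- y) \<le> 1 / (1 + y + y\<^sup>2 / 2)"
      using e p by (simp add: exp_minus divide_simps)
    also have "\<dots> \<le> 1 - y + y\<^sup>2 / 2"
    proof -
      have "1 \<le> 1 + y ^ 4 / 4" by simp
      also have "\<dots> = (1 - y + y\<^sup>2 / 2) * (1 + y + y\<^sup>2 / 2)"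
        by (simp add: power2_eq_square power4_eq_xxxx field_simps)
      finally show ?thesis using p by (simp add: pos_divide_le_eq)
    qed
    finally have "exp y + exp (- y) \<le> 2 + 2 * y\<^sup>2"
      using exp_bound[OF y] zero_le_power2[of y] by linarith
    also have "\<dots> \<le> 2 * exp (y\<^sup>2)"
      using exp_ge_add_one_self[of "y\<^sup>2"] by linarith
    finally show ?thesis .
  qed
  show ?thesis
    using *[of "\<bar>x\<bar>"] assms by (cases "x \<ge> 0") (auto simp: add.commute)
qed

subsection \<open>Averages over uniformly random subsets\<close>

text \<open>Expectation over \<open>n\<close> independent fair bits, encoded as the set of ones. A
  finite sum makes linearity algebraic and allows induction on \<open>n\<close>.\<close>

definition subset_avg :: "nat \<Rightarrow> (nat set \<Rightarrow> real) \<Rightarrow> real" where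
  "subset_avg n g = (\<Sum>B\<in>Pow {..<n}. g B) / 2 ^ n"

lemma subset_avg_0: "subset_avg 0 g = g {}"
  by (simp add: subset_avg_def)

lemma subset_avg_Suc:
  "subset_avg (Suc n) g = (subset_avg n g + subset_avg n (\<lambda>B. g (insert n B))) / 2"
proof -
  have "(\<Sum>B\<in>Pow {..<Suc n}. g B) = (\<Sum>B\<in>Pow {..<n}. g B) + (\<Sum>B\<in>insert n ` Pow {..<n}. g B)"
    unfolding lessThan_Suc Pow_insert by (intro sum.union_disjoint) auto
  also have "(\<Sum>B\<in>insert n ` Pow {..<n}. g B) = (\<Sum>B\<in>Pow {..<n}. g (insert n B))"
    by (subst sum.reindex) (auto simp: inj_on_def insert_eq_iff)
  finally show ?thesis by (simp add: subset_avg_def add_divide_distrib)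
qed

lemma subset_avg_mono: "(\<And>B. B \<subseteq> {..<n} \<Longrightarrow> f B \<le> g B) \<Longrightarrow> subset_avg n f \<le> subset_avg n g"
  unfolding subset_avg_def by (intro divide_right_mono sum_mono) auto

lemma subset_avg_cong: "(\<And>B. B \<subseteq> {..<n} \<Longrightarrow> f B = g B) \<Longrightarrow> subset_avg n f = subset_avg n g"
  unfolding subset_avg_def by (intro arg_cong2[where f = "(/)"] sum.cong) auto

lemma subset_avg_add: "subset_avg n (\<lambda>B. f B + g B) = subset_avg n f + subset_avg n g"
  by (simp add: subset_avg_def sum.distrib add_divide_distrib)

lemma subset_avg_cmult: "subset_avg n (\<lambda>B. c * f B) = c * subset_avg n f"
  by (simp add: subset_avg_def sum_distrib_left[symmetric])

lemma subset_avg_sum: "subset_avg n (\<lambda>B. \<Sum>l\<in>I. f l B) = (\<Sum>l\<in>I. subset_avg n (f l))"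
  by (simp add: subset_avg_def sum_divide_distrib[symmetric]) (rule sum.swap)

lemma subset_avg_const: "subset_avg n (\<lambda>_. c) = c"
  by (simp add: subset_avg_def card_Pow)

lemma subset_avg_nonneg: "(\<And>B. 0 \<le> f B) \<Longrightarrow> 0 \<le> subset_avg n f"
  unfolding subset_avg_def by (intro divide_nonneg_nonneg sum_nonneg) auto

lemma subset_avg_split:
  assumes "j < n"
  shows "subset_avg n g = (subset_avg n (\<lambda>B. g (B - {j})) + subset_avg n (\<lambda>B. g (insert j B))) / 2"
  using assms
proof (induction n arbitrary: g)
  case (Suc n)
  show ?case
  proof (cases "j = n")
    case True
    have "subset_avg n (\<lambda>B. g (B - {n})) = subset_avg n g"
      by (intro subset_avg_cong) (metis Diff_empty Diff_insert0 lessThan_iff less_irrefl subsetD)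
    with True show ?thesis by (simp add: subset_avg_Suc)
  next
    case False
    with Suc have "j < n" by simp
    have "insert n B - {j} = insert n (B - {j})" for B using False by auto
    then show ?thesis
      using Suc.IH[OF \<open>j < n\<close>, of g] Suc.IH[OF \<open>j < n\<close>, of "\<lambda>B. g (insert n B)"]
      by (simp add: subset_avg_Suc insert_commute[of n j] field_simps)
  qed
qed simp

text \<open>Independence of functions of disjoint blocks of bits. In the induction the new point
  \<open>n\<close> lies in at most one \<open>S i\<close>, so adding it to \<open>B\<close> changes
  at most one factor.\<close>

lemma subset_avg_prod_disjoint:
  fixes k :: nat
  assumes "\<And>i i'. i < k \<Longrightarrow> i' < k \<Longrightarrow> i \<noteq> i' \<Longrightarrow> S i \<inter> S i' = {}"
  shows "subset_avg n (\<lambda>B. \<Prod>i<k. g i (B \<inter> S i)) = (\<Prod>i<k. subset_avg n (\<lambda>B. g i (B \<inter> S i)))"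
proof (induction n arbitrary: g)
  case 0
  show ?case by (simp add: subset_avg_0)
next
  case (Suc n)
  define g' where "g' i T = g i (if n \<in> S i then insert n T else T)" for i T
  have ins: "g i (insert n B \<inter> S i) = g' i (B \<inter> S i)" for i B
    by (auto simp: g'_def Int_insert_left)
  define u where "u i = subset_avg n (\<lambda>B. g i (B \<inter> S i))" for i
  define v where "v i = subset_avg n (\<lambda>B. g' i (B \<inter> S i))" for i
  have "subset_avg (Suc n) (\<lambda>B. \<Prod>i<k. g i (B \<inter> S i)) = ((\<Prod>i<k. u i) + (\<Prod>i<k. v i)) / 2"
    unfolding subset_avg_Suc ins Suc.IH u_def v_def ..
  also have "\<dots> = (\<Prod>i<k. (u i + v i) / 2)"
  proof (cases "\<exists>i<k. n \<in> S i")
    case False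
    then have "u i = v i" if "i < k" for i using that by (auto simp: u_def v_def g'_def)
    then show ?thesis by simp
  next
    case True
    then obtain i where i: "i < k" "n \<in> S i" by blast
    have eq: "u i' = v i'" if "i' \<in> {..<k} - {i}" for i'
    proof -
      have "n \<notin> S i'" using assms[of i i'] i that by auto
      then show ?thesis by (simp add: u_def v_def g'_def)
    qed
    have "(\<Prod>i<k. u i) = u i * (\<Prod>i'\<in>{..<k}-{i}. v i')" "(\<Prod>i<k. v i) = v i * (\<Prod>i'\<in>{..<k}-{i}. v i')"
      "(\<Prod>i<k. (u i + v i) / 2) = (u i + v i) / 2 * (\<Prod>i'\<in>{..<k}-{i}. v i')"
      using i eq by (auto simp: prod.remove[of "{..<k}" i] intro!: prod.cong)
    then show ?thesis by (simp add: algebra_simps)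
  qed
  also have "\<dots> = (\<Prod>i<k. subset_avg (Suc n) (\<lambda>B. g i (B \<inter> S i)))"
    unfolding subset_avg_Suc ins u_def v_def ..
  finally show ?case .
qed

definition sgn_in :: "nat \<Rightarrow> nat set \<Rightarrow> real" where
  "sgn_in j B = (if j \<in> B then 1 else - 1)"

text \<open>The moment generating function of independent signs factors over coordinates, and each
  factor is a hyperbolic cosine.\<close>

lemma subset_avg_exp_le:
  assumes "\<And>j. \<bar>h j\<bar> \<le> 1"
  shows "subset_avg n (\<lambda>B. exp (\<Sum>j<n. h j * sgn_in j B)) \<le> exp (\<Sum>j<n. (h j)\<^sup>2)"
proof -
  have *: "subset_avg n (\<lambda>B. exp (\<Sum>j<n. h j * sgn_in j B)) = (\<Prod>j<n. (exp (h j) + exp (- h j)) / 2)"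
  proof (induction n)
    case 0
    show ?case by (simp add: subset_avg_0)
  next
    case (Suc n)
    have "subset_avg n (\<lambda>B. exp (\<Sum>j<Suc n. h j * sgn_in j B))
       = subset_avg n (\<lambda>B. exp (- h n) * exp (\<Sum>j<n. h j * sgn_in j B))"
      by (intro subset_avg_cong) (auto simp: exp_add[symmetric] sgn_in_def subset_eq)
    moreover have "subset_avg n (\<lambda>B. exp (\<Sum>j<Suc n. h j * sgn_in j (insert n B)))
       = subset_avg n (\<lambda>B. exp (h n) * exp (\<Sum>j<n. h j * sgn_in j B))"
      by (intro subset_avg_cong) (simp add: exp_add[symmetric] sgn_in_def)
    ultimately show ?case
      by (simp add: subset_avg_Suc subset_avg_cmult Suc.IH algebra_simps del: sum.lessThan_Suc)
  qed
  also have "\<dots> \<le> (\<Prod>j<n. exp ((h j)\<^sup>2))"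
    using exp_plus_exp_minus_le[OF assms] by (intro prod_mono) (auto simp: mult.commute)
  finally show ?thesis by (simp add: exp_sum)
qed

text \<open>Exponential moment method, tilting by half the bias vector; the factor 1/2 absorbs the crude
  bound on the hyperbolic cosine.\<close>

lemma level_one_inequality:
  fixes R :: "nat set \<Rightarrow> bool" and n :: nat
  defines "\<mu> \<equiv> subset_avg n (\<lambda>B. of_bool (R B))"
  assumes pos: "\<mu> > 0"
  shows "(\<Sum>j<n. (subset_avg n (\<lambda>B. of_bool (R B) * sgn_in j B) / \<mu>)\<^sup>2) \<le> 4 * ln (1 / \<mu>)"
proof -
  define \<alpha> where "\<alpha> j = subset_avg n (\<lambda>B. of_bool (R B) * sgn_in j B) / \<mu>" for j
  define s where "s = (\<Sum>j<n. (\<alpha> j)\<^sup>2)"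
  define L where "L B = (\<Sum>j<n. \<alpha> j / 2 * sgn_in j B)" for B
  have \<alpha>: "\<bar>\<alpha> j\<bar> \<le> 1" for j
  proof -
    have "subset_avg n (\<lambda>B. of_bool (R B) * sgn_in j B) \<le> \<mu>"
      unfolding \<mu>_def by (intro subset_avg_mono) (auto simp: sgn_in_def)
    moreover have "- \<mu> = subset_avg n (\<lambda>B. (-1) * of_bool (R B))"
      unfolding \<mu>_def subset_avg_cmult by simp
    moreover have "\<dots> \<le> subset_avg n (\<lambda>B. of_bool (R B) * sgn_in j B)"
      by (intro subset_avg_mono) (auto simp: sgn_in_def)
    ultimately show ?thesis using pos by (simp add: \<alpha>_def abs_le_iff divide_simps)
  qed
  have "subset_avg n (\<lambda>B. of_bool (R B) * L B) = subset_avg n (\<lambda>B. \<Sum>j<n. \<alpha> j / 2 * (of_bool (R B) * sgn_in j B))"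
    by (simp add: L_def sum_distrib_left mult_ac)
  also have "\<dots> = (\<Sum>j<n. \<alpha> j / 2 * (\<alpha> j * \<mu>))"
    using pos by (simp only: subset_avg_sum subset_avg_cmult) (simp add: \<alpha>_def)
  also have "\<dots> = s / 2 * \<mu>"
    by (simp add: s_def sum_distrib_left sum_distrib_right sum_divide_distrib power2_eq_square mult_ac)
  finally have EL: "subset_avg n (\<lambda>B. of_bool (R B) * L B) = s / 2 * \<mu>" .
  \<comment> \<open>The tangent to \<open>exp\<close> at \<open>s / 2\<close>, the mean of
    \<open>L\<close> conditioned on \<open>R\<close>, bounds \<open>exp (L B)\<close> from below on
    \<open>R\<close>; off \<open>R\<close> the lower bound is 0.\<close>
  have "exp (s / 2) * \<mu> = exp (s / 2) * ((1 - s / 2) * \<mu> + s / 2 * \<mu>)"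
    by (simp add: algebra_simps)
  also have "\<dots> = subset_avg n (\<lambda>B. exp (s/2) * ((1 - s / 2) * of_bool (R B) + of_bool (R B) * L B))"
    unfolding subset_avg_cmult subset_avg_add EL \<mu>_def ..
  also have "\<dots> \<le> subset_avg n (\<lambda>B. exp (L B))"
    using mult_exp_ge[of "s/2"] by (intro subset_avg_mono) (auto simp: algebra_simps)
  also have "\<dots> \<le> exp (\<Sum>j<n. (\<alpha> j / 2)\<^sup>2)"
    unfolding L_def using \<alpha> by (intro subset_avg_exp_le) (smt (verit) abs_divide field_sum_of_halves abs_ge_zero abs_numeral)
  also have "(\<Sum>j<n. (\<alpha> j / 2)\<^sup>2) = s / 4"
    by (simp add: s_def sum_divide_distrib power_divide)
  finally have "exp (s / 2) * \<mu> \<le> exp (s / 4)" .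
  then have "ln (exp (s / 2) * \<mu>) \<le> s / 4"
    using pos by (metis exp_gt_zero ln_exp ln_le_cancel_iff mult_pos_pos)
  then show ?thesis
    using pos by (simp add: ln_mult ln_div s_def \<alpha>_def)
qed

subsection \<open>Transcripts\<close>

fun paths :: "protocol \<Rightarrow> bool list set" where
  "paths (Leaf b) = {[]}"
| "paths (Node i f p0 p1) = (#) False ` paths p0 \<union> (#) True ` paths p1"

fun leaf_out :: "protocol \<Rightarrow> bool list \<Rightarrow> bool" where
  "leaf_out (Leaf b) \<pi> = b"
| "leaf_out (Node i f p0 p1) \<pi> = leaf_out (if hd \<pi> then p1 else p0) (tl \<pi>)"

text \<open>Side \<open>i\<close> of the combinatorial rectangle of inputs that reach the leaf
  \<open>\<pi>\<close>. As \<open>hd\<close> and \<open>tl\<close> steer the descent, this is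
  meaningful for \<open>\<pi>\<close> in \<open>paths P\<close>.\<close>

fun rect :: "protocol \<Rightarrow> bool list \<Rightarrow> nat \<Rightarrow> (nat \<Rightarrow> bool) set" where
  "rect (Leaf b) \<pi> i = UNIV"
| "rect (Node i' f p0 p1) \<pi> i =
     rect (if hd \<pi> then p1 else p0) (tl \<pi>) i \<inter> (if i' = i then {x. f x = hd \<pi>} else UNIV)"

fun turns :: "nat \<Rightarrow> protocol \<Rightarrow> bool list \<Rightarrow> nat" where
  "turns i (Leaf b) \<pi> = 0"
| "turns i (Node i' f p0 p1) \<pi> = (if i' = i then 1 else 0) + turns i (if hd \<pi> then p1 else p0) (tl \<pi>)"

lemma finite_paths [simp]: "finite (paths P)"
  by (induction P) auto

lemma sum_paths_Node:
  "(\<Sum>\<pi>\<in>paths (Node i f p0 p1). F \<pi>) = (\<Sum>\<pi>\<in>paths p0. F (False # \<pi>)) + (\<Sum>\<pi>\<in>paths p1. F (True # \<pi>))"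
  unfolding paths.simps by (subst sum.union_disjoint) (auto simp: sum.reindex)

lemma run_eq_leaf_out:
  assumes "\<pi> \<in> paths P" "\<And>i. i \<in> speakers P \<Longrightarrow> X i \<in> rect P \<pi> i"
  shows "run P X = leaf_out P \<pi>" "bits_of i P X = turns i P \<pi>"
  using assms
proof (induction P arbitrary: \<pi>)
  case (Node i' f p0 p1)
  {
    case 1
    have "f (X i') = hd \<pi>" using 1(2)[of i'] by simp
    moreover have "X i \<in> rect (if hd \<pi> then p1 else p0) (tl \<pi>) i" if "i \<in> speakers (if hd \<pi> then p1 else p0)" for i
      using 1(2)[of i] that by (auto split: if_splits)
    ultimately show ?case using 1(1) Node.IH(1)[of "tl \<pi>"] Node.IH(3)[of "tl \<pi>"] by (auto split: if_splits)
  next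
    case 2
    have "f (X i') = hd \<pi>" using 2(2)[of i'] by simp
    moreover have "X i \<in> rect (if hd \<pi> then p1 else p0) (tl \<pi>) i" if "i \<in> speakers (if hd \<pi> then p1 else p0)" for i
      using 2(2)[of i] that by (auto split: if_splits)
    ultimately show ?case using 2(1) Node.IH(2)[of "tl \<pi>"] Node.IH(4)[of "tl \<pi>"] by (auto split: if_splits)
  }
qed auto

text \<open>Replacing the behaviour of player \<open>i0\<close> by fair coins still yields a distribution on transcripts;
  for \<open>i0 \<ge> k\<close> no player is replaced.\<close>

lemma sum_paths_prod:
  fixes v :: "nat \<Rightarrow> (nat \<Rightarrow> bool) set \<Rightarrow> real"
  assumes "speakers P \<subseteq> {..<k}"
    and add: "\<And>i A E. v i A = v i (A \<inter> E) + v i (A \<inter> - E)"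
  shows "(\<Sum>\<pi>\<in>paths P. \<Prod>i<k. if i = i0 then (1/2) ^ turns i0 P \<pi> else v i (A i \<inter> rect P \<pi> i))
    = (\<Prod>i<k. if i = i0 then 1 else v i (A i))"
  using assms(1)
proof (induction P arbitrary: A)
  case (Leaf b)
  show ?case by (simp cong: if_cong)
next
  case (Node i f p0 p1)
  define E where "E b = {x. f x = b}" for b
  define A' where "A' b = A(i := A i \<inter> E b)" for b
  \<comment> \<open>The coin of the replaced player: each of that player's turns costs a factor
    \<open>1/2\<close>, independent of the set \<open>A i\<close>.\<close>
  define h :: real where "h = (if i = i0 then 1/2 else 1)"
  define V where "V B i' = (if i' = i0 then 1 else v i' (B i'))" for B i'
  have i: "i < k" using Node.prems by auto
  have step: "(\<Prod>i'<k. if i' = i0 then (1/2) ^ turns i0 (Node i f p0 p1) (b # \<pi>) else v i' (A i' \<inter> rect (Node i f p0 p1) (b # \<pi>) i'))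
     = h * (\<Prod>i'<k. if i' = i0 then (1/2) ^ turns i0 (if b then p1 else p0) \<pi> else v i' (A' b i' \<inter> rect (if b then p1 else p0) \<pi> i'))"
    (is "prod ?l _ = h * prod ?r _") for b \<pi>
  proof -
    have "?l i = h * ?r i" using i by (auto simp: h_def A'_def E_def Int_ac)
    moreover have "?l i' = ?r i'" if "i' \<in> {..<k} - {i}" for i'
      using that by (auto simp: A'_def)
    ultimately show ?thesis
      using i by (simp only: prod.remove[of "{..<k}" i] finite_lessThan lessThan_iff mult.assoc cong: prod.cong)
  qed
  have IH: "(\<Sum>\<pi>\<in>paths (if b then p1 else p0). \<Prod>i'<k. if i' = i0 then (1/2) ^ turns i0 (if b then p1 else p0) \<pi>
        else v i' (A' b i' \<inter> rect (if b then p1 else p0) \<pi> i')) = (\<Prod>i'<k. V (A' b) i')" for b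
    unfolding V_def using Node.IH[of "A' b"] Node.prems by (cases b) simp_all
  have "(\<Sum>\<pi>\<in>paths (Node i f p0 p1). \<Prod>i'<k. if i' = i0 then (1/2) ^ turns i0 (Node i f p0 p1) \<pi>
      else v i' (A i' \<inter> rect (Node i f p0 p1) \<pi> i')) = h * (\<Prod>i'<k. V (A' False) i') + h * (\<Prod>i'<k. V (A' True) i')"
    unfolding sum_paths_Node step sum_distrib_left[symmetric]
    using IH[of False] IH[of True] by simp
  also have "\<dots> = (h * V (A' False) i + h * V (A' True) i) * (\<Prod>i'\<in>{..<k}-{i}. V A i')"
  proof -
    have "(\<Prod>i'<k. V (A' b) i') = V (A' b) i * (\<Prod>i'\<in>{..<k}-{i}. V A i')" for b
    proof -
      have "(\<Prod>i'\<in>{..<k}-{i}. V (A' b) i') = (\<Prod>i'\<in>{..<k}-{i}. V A i')"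
        by (intro prod.cong refl) (simp add: V_def A'_def)
      then show ?thesis using i by (simp add: prod.remove)
    qed
    then show ?thesis by (simp add: algebra_simps)
  qed
  \<comment> \<open>For \<open>i = i0\<close> this is \<open>1/2 + 1/2 = 1\<close>; for any other
    speaker it is additivity of \<open>v i\<close> over the two values of the bit written.\<close>
  also have "h * V (A' False) i + h * V (A' True) i = V A i"
  proof -
    have "- E False = E True" by (auto simp: E_def)
    then show ?thesis using add[of i "A i" "E False"] by (simp add: h_def V_def A'_def)
  qed
  also have "V A i * (\<Prod>i'\<in>{..<k}-{i}. V A i') = (\<Prod>i'<k. V A i')"
    using i by (simp add: prod.remove)
  finally show ?case by (simp add: V_def)
qed

text \<open>Independent players induce a probability distribution on leaves. It is applied to point
  masses, to \<open>mass\<close>, and to mixtures of two masses.\<close>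

lemma sum_paths_prod_additive:
  fixes v :: "nat \<Rightarrow> (nat \<Rightarrow> bool) set \<Rightarrow> real"
  assumes "speakers P \<subseteq> {..<k}" "\<And>i A E. v i A = v i (A \<inter> E) + v i (A \<inter> - E)" "\<And>i. v i UNIV = 1"
  shows "(\<Sum>\<pi>\<in>paths P. \<Prod>i<k. v i (rect P \<pi> i)) = 1"
proof -
  have "(\<Sum>\<pi>\<in>paths P. \<Prod>i<k. v i (rect P \<pi> i))
    = (\<Sum>\<pi>\<in>paths P. \<Prod>i<k. if i = k then (1/2) ^ turns k P \<pi> else v i (UNIV \<inter> rect P \<pi> i))"
    by (intro sum.cong prod.cong) auto
  also have "\<dots> = 1"
    by (subst sum_paths_prod[where v = v and A = "\<lambda>_. UNIV", OF assms(1,2)]) (auto simp: assms(3))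
  finally show ?thesis .
qed

text \<open>For point masses the leaf products are 0 or 1 and sum to 1, so an input selects a single
  leaf, whose label is the output.\<close>

lemma of_bool_run_eq_sum_paths:
  assumes "speakers P \<subseteq> {..<k}"
  shows "(of_bool (run P X = b) :: real)
    = (\<Sum>\<pi>\<in>{\<pi>\<in>paths P. leaf_out P \<pi> = b}. \<Prod>i<k. of_bool (X i \<in> rect P \<pi> i))"
proof -
  have one: "(\<Sum>\<pi>\<in>paths P. \<Prod>i<k. of_bool (X i \<in> rect P \<pi> i)) = (1::real)"
    by (rule sum_paths_prod_additive[OF assms]) auto
  have "(of_bool (run P X = b) :: real) = (\<Sum>\<pi>\<in>paths P. of_bool (run P X = b) * (\<Prod>i<k. of_bool (X i \<in> rect P \<pi> i)))"
    by (simp only: sum_distrib_left[symmetric] one)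
  also have "\<dots> = (\<Sum>\<pi>\<in>paths P. if leaf_out P \<pi> = b then (\<Prod>i<k. of_bool (X i \<in> rect P \<pi> i)) else 0)"
  proof (rule sum.cong[OF refl])
    fix \<pi> assume \<pi>: "\<pi> \<in> paths P"
    show "of_bool (run P X = b) * (\<Prod>i<k. of_bool (X i \<in> rect P \<pi> i))
      = (if leaf_out P \<pi> = b then (\<Prod>i<k. of_bool (X i \<in> rect P \<pi> i)) else (0::real))"
    proof (cases "\<forall>i<k. X i \<in> rect P \<pi> i")
      case True
      then have "run P X = leaf_out P \<pi>" using run_eq_leaf_out(1)[OF \<pi>] assms by blast
      then show ?thesis by simp
    next
      case False
      then have "(\<Prod>i<k. of_bool (X i \<in> rect P \<pi> i)) = (0::real)" by auto
      then show ?thesis by simp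
    qed
  qed
  finally show ?thesis by (simp add: sum.inter_filter)
qed

subsection \<open>Information revealed about the hidden coordinates\<close>

text \<open>Coordinates in \<open>S\<close> are uniform bits, those in \<open>T\<close> are 1, all others are 0.\<close>

definition mass :: "nat \<Rightarrow> nat set \<Rightarrow> nat set \<Rightarrow> (nat \<Rightarrow> bool) set \<Rightarrow> real" where
  "mass n T S R = subset_avg n (\<lambda>B. of_bool ((\<lambda>x. x \<in> T \<union> B \<inter> S) \<in> R))"

lemma mass_nonneg: "0 \<le> mass n T S R"
  unfolding mass_def by (intro subset_avg_nonneg) auto

lemma mass_UNIV: "mass n T S UNIV = 1"
  by (simp add: mass_def subset_avg_const)

lemma mass_additive: "mass n T S A = mass n T S (A \<inter> E) + mass n T S (A \<inter> - E)"
  unfolding mass_def subset_avg_add[symmetric] by (intro subset_avg_cong) auto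

lemma mass_pos_nonempty:
  assumes "0 < mass n T S R" shows "R \<noteq> {}"
  using assms by (auto simp: mass_def subset_avg_const)

text \<open>Conditioning on the fair bit \<open>j\<close>: the two cases average to the mass, and
  their half difference is its first-order coefficient at \<open>j\<close>.\<close>

lemma mass_split:
  assumes "j \<in> S" "j < n"
  shows "mass n {} S R = (mass n {} (S - {j}) R + mass n {j} (S - {j}) R) / 2"
    and "subset_avg n (\<lambda>B. of_bool ((\<lambda>x. x \<in> {} \<union> B \<inter> S) \<in> R) * sgn_in j B)
      = (mass n {j} (S - {j}) R - mass n {} (S - {j}) R) / 2"
proof -
  have 0: "(B - {j}) \<inter> S = B \<inter> (S - {j})" and 1: "insert j B \<inter> S = insert j (B \<inter> (S - {j}))" for B
    using assms by auto
  show "mass n {} S R = (mass n {} (S - {j}) R + mass n {j} (S - {j}) R) / 2"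
    unfolding mass_def by (subst subset_avg_split[OF assms(2)]) (simp only: 0 1 Un_empty_left insert_is_Un[symmetric])
  have "subset_avg n (\<lambda>B. of_bool ((\<lambda>x. x \<in> {} \<union> B \<inter> S) \<in> R) * sgn_in j B)
    = (subset_avg n (\<lambda>B. (-1) * of_bool ((\<lambda>x. x \<in> {} \<union> B \<inter> (S - {j})) \<in> R))
      + subset_avg n (\<lambda>B. of_bool ((\<lambda>x. x \<in> {j} \<union> B \<inter> (S - {j})) \<in> R))) / 2"
    by (subst subset_avg_split[OF assms(2)])
      (simp only: 0 1 Un_empty_left insert_is_Un[symmetric], simp add: sgn_in_def)
  then show "subset_avg n (\<lambda>B. of_bool ((\<lambda>x. x \<in> {} \<union> B \<inter> S) \<in> R) * sgn_in j B)
      = (mass n {j} (S - {j}) R - mass n {} (S - {j}) R) / 2"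
    unfolding subset_avg_cmult mass_def by simp
qed

text \<open>By \<open>mass_split\<close> each quotient is the conditional bias of bit
  \<open>j\<close> given the rectangle side, the halves cancelling, so the level-one inequality
  applies.\<close>

lemma mass_level_one:
  assumes "S \<subseteq> {..<n}" "mass n {} S R > 0"
  shows "(\<Sum>j\<in>S. ((mass n {j} (S - {j}) R - mass n {} (S - {j}) R)
      / (mass n {} (S - {j}) R + mass n {j} (S - {j}) R))\<^sup>2) \<le> 4 * ln (1 / mass n {} S R)"
proof -
  have "(\<Sum>j\<in>S. ((mass n {j} (S - {j}) R - mass n {} (S - {j}) R)
      / (mass n {} (S - {j}) R + mass n {j} (S - {j}) R))\<^sup>2)
    = (\<Sum>j\<in>S. (subset_avg n (\<lambda>B. of_bool ((\<lambda>x. x \<in> {} \<union> B \<inter> S) \<in> R) * sgn_in j B) / mass n {} S R)\<^sup>2)"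
  proof (rule sum.cong[OF refl])
    have half: "x / y = (x / 2) / (y / 2)" for x y :: real by simp
    fix j assume "j \<in> S"
    then have j: "j \<in> S" "j < n" using assms by auto
    show "((mass n {j} (S - {j}) R - mass n {} (S - {j}) R)
      / (mass n {} (S - {j}) R + mass n {j} (S - {j}) R))\<^sup>2
      = (subset_avg n (\<lambda>B. of_bool ((\<lambda>x. x \<in> {} \<union> B \<inter> S) \<in> R) * sgn_in j B) / mass n {} S R)\<^sup>2"
      unfolding mass_split[OF j] by (rule arg_cong[OF half])
  qed
  also have "\<dots> \<le> (\<Sum>j<n. (subset_avg n (\<lambda>B. of_bool ((\<lambda>x. x \<in> {} \<union> B \<inter> S) \<in> R) * sgn_in j B) / mass n {} S R)\<^sup>2)"
    using assms by (intro sum_mono2) auto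
  also have "\<dots> \<le> 4 * ln (1 / mass n {} S R)"
    using level_one_inequality[of n "\<lambda>B. (\<lambda>x. x \<in> {} \<union> B \<inter> S) \<in> R"] assms(2) unfolding mass_def by simp
  finally show ?thesis .
qed

text \<open>Gibbs' inequality against the transcript distribution in which player \<open>i\<close> writes fair coins.\<close>

lemma expected_log_mass_le:
  assumes P: "bounded_protocol k c P" and i: "i < k"
  shows "(\<Sum>\<pi>\<in>paths P. (\<Prod>i'<k. mass n {} (S i') (rect P \<pi> i')) * ln (1 / mass n {} (S i) (rect P \<pi> i))) \<le> ln 2 * c i"
proof -
  define M where "M i' \<pi> = mass n {} (S i') (rect P \<pi> i')" for i' \<pi>
  define K where "K \<pi> = (\<Prod>i'\<in>{..<k}-{i}. M i' \<pi>)" for \<pi>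
  have sp: "speakers P \<subseteq> {..<k}" and bits: "bits_of i P X \<le> c i" for X
    using P i by (auto simp: bounded_protocol_def)
  have Mnn: "0 \<le> M i' \<pi>" for i' \<pi> by (simp add: M_def mass_nonneg)
  have Knn: "0 \<le> K \<pi>" for \<pi> by (simp add: K_def Mnn prod_nonneg)
  have prodM: "(\<Prod>i'<k. M i' \<pi>) = M i \<pi> * K \<pi>" for \<pi>
    using i by (simp add: K_def prod.remove)
  have total: "(\<Sum>\<pi>\<in>paths P. M i \<pi> * K \<pi>) = 1"
    unfolding prodM[symmetric] unfolding M_def
    by (rule sum_paths_prod_additive[where v = "\<lambda>i'. mass n {} (S i')", OF sp]) (rule mass_additive, rule mass_UNIV)
  have coins: "(\<Sum>\<pi>\<in>paths P. (1/2) ^ turns i P \<pi> * K \<pi>) = 1"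
  proof -
    have "(\<Sum>\<pi>\<in>paths P. (1/2) ^ turns i P \<pi> * K \<pi>)
      = (\<Sum>\<pi>\<in>paths P. \<Prod>i'<k. if i' = i then (1/2) ^ turns i P \<pi> else mass n {} (S i') (UNIV \<inter> rect P \<pi> i'))"
      using i by (intro sum.cong refl, subst prod.remove[of "{..<k}" i]) (auto simp: K_def M_def intro!: prod.cong)
    also have "\<dots> = 1"
      by (subst sum_paths_prod[OF sp, of "\<lambda>i'. mass n {} (S i')"])
        (rule mass_additive, auto simp: mass_UNIV intro!: prod.neutral)
    finally show ?thesis .
  qed
  have "(\<Sum>\<pi>\<in>paths P. (M i \<pi> * K \<pi>) * ln (1 / M i \<pi>))
     \<le> (\<Sum>\<pi>\<in>paths P. ln 2 * c i * (M i \<pi> * K \<pi>) + ((1/2) ^ turns i P \<pi> * K \<pi> - M i \<pi> * K \<pi>))"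
  proof (rule sum_mono)
    fix \<pi> assume \<pi>: "\<pi> \<in> paths P"
    show "(M i \<pi> * K \<pi>) * ln (1 / M i \<pi>) \<le> ln 2 * c i * (M i \<pi> * K \<pi>) + ((1/2) ^ turns i P \<pi> * K \<pi> - M i \<pi> * K \<pi>)"
    proof (cases "\<forall>i'<k. M i' \<pi> > 0")
      case False
      then obtain i' where "i' < k" "M i' \<pi> = 0" using Mnn by (metis less_eq_real_def)
      then have zero: "M i \<pi> * K \<pi> = 0" unfolding prodM[symmetric] by auto
      show ?thesis unfolding zero using Knn by simp
    next
      case True
      \<comment> \<open>Positive masses provide an actual input reaching the leaf, and only then
        does the protocol bound limit \<open>turns\<close>. Leaves of product mass zero were treated
        separately.\<close>
      then have "\<forall>i'. \<exists>x. i' < k \<longrightarrow> x \<in> rect P \<pi> i'"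
        unfolding M_def using mass_pos_nonempty by blast
      then obtain X where "\<And>i'. i' < k \<Longrightarrow> X i' \<in> rect P \<pi> i'" by metis
      then have "turns i P \<pi> \<le> c i"
        using run_eq_leaf_out(2)[OF \<pi>, of X i] sp bits[of X] by (metis lessThan_iff subsetD)
      define m d where "m = M i \<pi>" and "d = turns i P \<pi>"
      have m: "m > 0" using True i by (simp add: m_def)
      \<comment> \<open>Splits the logarithm into at most \<open>c i\<close> bits and a log
        likelihood ratio. The latter is bounded by \<open>ln t \<le> t - 1\<close>, whose weighted
        terms cancel in the sum by \<open>coins\<close> and \<open>total\<close>.\<close>
      have "1 / m = 2 ^ d * ((1/2) ^ d / m)" by (simp add: power_one_over)
      then have "ln (1 / m) = d * ln 2 + ln ((1/2) ^ d / m)"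
        using m by (metis ln_mult_pos ln_realpow divide_pos_pos zero_less_numeral zero_less_power half_gt_zero zero_less_one)
      also have "\<dots> \<le> c i * ln 2 + ((1/2) ^ d / m - 1)"
        using m \<open>turns i P \<pi> \<le> c i\<close> by (intro add_mono mult_right_mono ln_le_minus_one) (auto simp: d_def)
      finally have "(m * K \<pi>) * ln (1 / m) \<le> (m * K \<pi>) * (c i * ln 2 + ((1/2) ^ d / m - 1))"
        using m Knn[of \<pi>] by (intro mult_left_mono) auto
      also have "\<dots> = ln 2 * c i * (m * K \<pi>) + ((1/2) ^ d * K \<pi> - m * K \<pi>)"
        using m by (simp add: field_simps)
      finally show ?thesis by (simp add: m_def d_def)
    qed
  qed
  also have "\<dots> = ln 2 * c i"
    by (simp only: sum.distrib sum_subtractf sum_distrib_left[symmetric] total coins)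
  finally show ?thesis by (simp only: prodM[unfolded M_def] M_def)
qed

text \<open>The triangular discrimination between the transcripts when column \<open>j\<close> is zero and when it is
  the unit column of player \<open>i\<close>; a vanishing denominator forces a vanishing numerator.\<close>

definition coordinate_discrepancy :: "nat \<Rightarrow> nat \<Rightarrow> protocol \<Rightarrow> (nat \<Rightarrow> nat set) \<Rightarrow> nat \<Rightarrow> nat \<Rightarrow> real" where
  "coordinate_discrepancy n k P S i j = (\<Sum>\<pi>\<in>paths P.
     (mass n {j} (S i - {j}) (rect P \<pi> i) - mass n {} (S i - {j}) (rect P \<pi> i))\<^sup>2
       / (mass n {} (S i - {j}) (rect P \<pi> i) + mass n {j} (S i - {j}) (rect P \<pi> i))
     * (\<Prod>i'\<in>{..<k}-{i}. mass n {} (S i' - {j}) (rect P \<pi> i')))"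

lemma coordinate_discrepancy_nonneg: "0 \<le> coordinate_discrepancy n k P S i j"
  unfolding coordinate_discrepancy_def
  by (intro sum_nonneg mult_nonneg_nonneg divide_nonneg_nonneg prod_nonneg add_nonneg_nonneg) (auto intro: mass_nonneg)

text \<open>When \<open>i\<close> owns \<open>j\<close>, the discrepancy is twice the expected
  squared bias of bit \<open>j\<close> given the transcript. Summed over the owned columns, the
  level-one inequality turns this into an expected log mass, hence into \<open>c i\<close>.\<close>

lemma sum_coordinate_discrepancy_le:
  assumes P: "bounded_protocol k c P" and i: "i < k"
    and S: "\<And>i. i < k \<Longrightarrow> S i \<subseteq> {..<n}" "\<And>i i'. i < k \<Longrightarrow> i' < k \<Longrightarrow> i \<noteq> i' \<Longrightarrow> S i \<inter> S i' = {}"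
  shows "(\<Sum>j\<in>S i. coordinate_discrepancy n k P S i j) \<le> 6 * c i"
proof -
  define M where "M i' \<pi> = mass n {} (S i') (rect P \<pi> i')" for i' \<pi>
  define a where "a j \<pi> = mass n {} (S i - {j}) (rect P \<pi> i)" for j \<pi>
  define b where "b j \<pi> = mass n {j} (S i - {j}) (rect P \<pi> i)" for j \<pi>
  have Mnn: "0 \<le> M i' \<pi>" for i' \<pi> by (simp add: M_def mass_nonneg)
  have fin: "finite (S i)" using S(1)[OF i] finite_subset by blast
  have disc: "coordinate_discrepancy n k P S i j
     = (\<Sum>\<pi>\<in>paths P. 2 * ((\<Prod>i'<k. M i' \<pi>) * ((b j \<pi> - a j \<pi>) / (a j \<pi> + b j \<pi>))\<^sup>2))" if j: "j \<in> S i" for j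
  proof -
    have "j < n" using j S(1)[OF i] by auto
    have sep: "S i' - {j} = S i'" if "i' \<in> {..<k}-{i}" for i'
      using S(2)[of i i'] i j that by auto
    \<comment> \<open>Here \<open>s / 2\<close> becomes the mass of player \<open>i\<close> with bit
      \<open>j\<close> still uniform; for \<open>s = 0\<close> both sides vanish by the division
      convention.\<close>
    have rearrange: "d\<^sup>2 / s * K = 2 * ((s / 2 * K) * (d / s)\<^sup>2)" for d s K :: real
      by (cases "s = 0") (simp_all add: field_simps power2_eq_square)
    show ?thesis
      unfolding coordinate_discrepancy_def
    proof (rule sum.cong[OF refl])
      fix \<pi>
      have "(\<Prod>i'<k. M i' \<pi>) = M i \<pi> * (\<Prod>i'\<in>{..<k}-{i}. M i' \<pi>)"
        using i by (simp add: prod.remove)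
      moreover have "M i \<pi> = (a j \<pi> + b j \<pi>) / 2"
        unfolding M_def a_def b_def by (rule mass_split(1)[OF j \<open>j < n\<close>])
      moreover have "(\<Prod>i'\<in>{..<k}-{i}. mass n {} (S i' - {j}) (rect P \<pi> i')) = (\<Prod>i'\<in>{..<k}-{i}. M i' \<pi>)"
        using sep by (intro prod.cong) (auto simp: M_def)
      ultimately show "(mass n {j} (S i - {j}) (rect P \<pi> i) - mass n {} (S i - {j}) (rect P \<pi> i))\<^sup>2
       / (mass n {} (S i - {j}) (rect P \<pi> i) + mass n {j} (S i - {j}) (rect P \<pi> i))
        * (\<Prod>i'\<in>{..<k}-{i}. mass n {} (S i' - {j}) (rect P \<pi> i'))
        = 2 * ((\<Prod>i'<k. M i' \<pi>) * ((b j \<pi> - a j \<pi>) / (a j \<pi> + b j \<pi>))\<^sup>2)"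
        unfolding a_def[symmetric] b_def[symmetric] by (simp only: rearrange)
    qed
  qed
  have "(\<Sum>j\<in>S i. coordinate_discrepancy n k P S i j)
    = (\<Sum>j\<in>S i. \<Sum>\<pi>\<in>paths P. 2 * ((\<Prod>i'<k. M i' \<pi>) * ((b j \<pi> - a j \<pi>) / (a j \<pi> + b j \<pi>))\<^sup>2))"
    by (intro sum.cong refl disc)
  also have "\<dots> = (\<Sum>\<pi>\<in>paths P. 2 * ((\<Prod>i'<k. M i' \<pi>) * (\<Sum>j\<in>S i. ((b j \<pi> - a j \<pi>) / (a j \<pi> + b j \<pi>))\<^sup>2)))"
    by (subst sum.swap) (simp add: sum_distrib_left)
  also have "\<dots> \<le> (\<Sum>\<pi>\<in>paths P. 2 * ((\<Prod>i'<k. M i' \<pi>) * (4 * ln (1 / M i \<pi>))))"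
  proof (rule sum_mono)
    fix \<pi>
    show "2 * ((\<Prod>i'<k. M i' \<pi>) * (\<Sum>j\<in>S i. ((b j \<pi> - a j \<pi>) / (a j \<pi> + b j \<pi>))\<^sup>2))
      \<le> 2 * ((\<Prod>i'<k. M i' \<pi>) * (4 * ln (1 / M i \<pi>)))"
    proof (cases "M i \<pi> = 0")
      case True
      then have zero: "(\<Prod>i'<k. M i' \<pi>) = 0" using i by auto
      show ?thesis unfolding zero by simp
    next
      case False
      then have "M i \<pi> > 0" using Mnn[of i \<pi>] by simp
      then show ?thesis
        using mass_level_one[OF S(1)[OF i], of "rect P \<pi> i"]
        by (intro mult_left_mono prod_nonneg ballI Mnn) (auto simp: M_def a_def b_def)
    qed
  qed
  also have "\<dots> = 8 * (\<Sum>\<pi>\<in>paths P. (\<Prod>i'<k. M i' \<pi>) * ln (1 / M i \<pi>))"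
    by (simp add: sum_distrib_left)
  also have "\<dots> \<le> 8 * (ln 2 * c i)"
    using expected_log_mass_le[OF P i, of n S] by (simp add: M_def)
  \<comment> \<open>The bound \<open>ln 2 \<le> 25/36\<close> gives
    \<open>8 * ln 2 < 6\<close>.\<close>
  also have "\<dots> \<le> 6 * c i"
    using mult_right_mono[OF ln2_le_25_over_36, of "real (c i)"] of_nat_0_le_iff[of "c i"] by linarith
  finally show ?thesis .
qed

subsection \<open>The input distribution as a mixture over the hidden choices\<close>

lemma pmf_choice_pmf:
  assumes "sub_distribution k \<nu>"
  shows "pmf (choice_pmf k \<nu>) w = (case w of None \<Rightarrow> 1 - (\<Sum>i<k. \<nu> i) | Some i \<Rightarrow> (if i < k then \<nu> i else 0))"
  unfolding choice_pmf_def
proof (rule pmf_embed_pmf)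
  let ?f = "\<lambda>w. case w of None \<Rightarrow> 1 - (\<Sum>i<k. \<nu> i) | Some i \<Rightarrow> (if i < k then \<nu> i else 0)"
  show nn: "0 \<le> ?f w" for w
    using assms by (auto simp: sub_distribution_def split: option.split)
  have "(\<integral>\<^sup>+ w. ennreal (?f w) \<partial>count_space UNIV) = (\<Sum>w\<in>insert None (Some ` {..<k}). ennreal (?f w))"
    by (intro nn_integral_count_space') (auto split: option.splits)
  also have "\<dots> = ennreal (\<Sum>w\<in>insert None (Some ` {..<k}). ?f w)"
    using nn by (intro sum_ennreal)
  also have "(\<Sum>w\<in>insert None (Some ` {..<k}). ?f w) = 1"
    by (subst sum.insert) (auto simp: sum.reindex)
  finally show "(\<integral>\<^sup>+ w. ennreal (?f w) \<partial>count_space UNIV) = 1" by simp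
qed

lemma finite_set_choice_pmf:
  assumes "sub_distribution k \<nu>"
  shows "finite (set_pmf (choice_pmf k \<nu>))"
proof (rule finite_subset)
  show "set_pmf (choice_pmf k \<nu>) \<subseteq> insert None (Some ` {..<k})"
  proof
    fix w assume "w \<in> set_pmf (choice_pmf k \<nu>)"
    then show "w \<in> insert None (Some ` {..<k})"
      by (cases w) (auto simp: set_pmf_eq pmf_choice_pmf[OF assms] split: if_splits)
  qed
qed simp

text \<open>The hidden owners \<open>W\<close> of the columns; \<open>None\<close> marks a column
  that is all zero.\<close>

definition choices_pmf :: "nat \<Rightarrow> nat \<Rightarrow> (nat \<Rightarrow> real) \<Rightarrow> (nat \<Rightarrow> nat option) pmf" where
  "choices_pmf n k \<nu> = Pi_pmf {..<n} None (\<lambda>_. choice_pmf k \<nu>)"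

definition cells :: "nat \<Rightarrow> (nat \<Rightarrow> nat option) \<Rightarrow> nat \<Rightarrow> nat set" where
  "cells n W i = {j. j < n \<and> W j = Some i}"

lemma finite_set_choices_pmf:
  assumes "sub_distribution k \<nu>"
  shows "finite (set_pmf (choices_pmf n k \<nu>))"
  unfolding choices_pmf_def by (simp add: set_Pi_pmf finite_PiE_dflt finite_set_choice_pmf[OF assms])

text \<open>Drawing all owners first leaves one fair bit per column. A single random set
  \<open>B\<close> serves all players because their cells are disjoint; its bits on unowned columns
  are ignored.\<close>

lemma D0_eq:
  "D0 n k \<nu> = choices_pmf n k \<nu> \<bind> (\<lambda>W. pmf_of_set (Pow {..<n}) \<bind>
     (\<lambda>B. return_pmf (\<lambda>i j. j \<in> B \<inter> cells n W i)))"
proof -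
  define g where "g = (\<lambda>(w :: nat option) b i'. case w of None \<Rightarrow> False | Some i \<Rightarrow> (i' = i \<and> b))"
  have col: "(\<lambda>i j. (if j < n then g (W j) (h j) else (\<lambda>_. False)) i)
     = (\<lambda>i j. j \<in> {j\<in>{..<n}. h j} \<inter> cells n W i)" for W h
    by (auto simp: g_def cells_def fun_eq_iff split: option.splits)
  have "Pi_pmf {..<n} (\<lambda>_. False) (\<lambda>_. column_pmf k \<nu>)
     = choices_pmf n k \<nu> \<bind> (\<lambda>W. Pi_pmf {..<n} (\<lambda>_. False) (\<lambda>j. bernoulli_pmf (1/2) \<bind> (\<lambda>b. return_pmf (g (W j) b))))"
    unfolding column_pmf_def choices_pmf_def g_def by (rule Pi_pmf_bind) simp
  also have "\<dots> = choices_pmf n k \<nu> \<bind> (\<lambda>W. Pi_pmf {..<n} False (\<lambda>_. bernoulli_pmf (1/2)) \<bind>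
      (\<lambda>h. return_pmf (\<lambda>j. if j < n then g (W j) (h j) else (\<lambda>_. False))))"
    by (subst Pi_pmf_bind[where d' = False]) simp_all
  finally have "D0 n k \<nu> = choices_pmf n k \<nu> \<bind> (\<lambda>W. Pi_pmf {..<n} False (\<lambda>_. bernoulli_pmf (1/2)) \<bind>
      (\<lambda>h. return_pmf (\<lambda>i j. (if j < n then g (W j) (h j) else (\<lambda>_. False)) i)))"
    by (simp add: D0_def map_bind_pmf)
  also have "\<dots> = choices_pmf n k \<nu> \<bind> (\<lambda>W. map_pmf (\<lambda>h. {j\<in>{..<n}. h j}) (Pi_pmf {..<n} False (\<lambda>_. bernoulli_pmf (1/2))) \<bind>
      (\<lambda>B. return_pmf (\<lambda>i j. j \<in> B \<inter> cells n W i)))"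
    unfolding col by (simp add: bind_map_pmf)
  finally show ?thesis unfolding pmf_of_set_Pow_conv_bernoulli[OF finite_lessThan] .
qed

text \<open>Expectation over \<open>W\<close> as a finite sum over the support, which spares
  integrability conditions.\<close>

definition choices_avg :: "nat \<Rightarrow> nat \<Rightarrow> (nat \<Rightarrow> real) \<Rightarrow> ((nat \<Rightarrow> nat option) \<Rightarrow> real) \<Rightarrow> real" where
  "choices_avg n k \<nu> F = (\<Sum>W\<in>set_pmf (choices_pmf n k \<nu>). pmf (choices_pmf n k \<nu>) W * F W)"

lemma choices_avg_mono: "(\<And>W. F W \<le> G W) \<Longrightarrow> choices_avg n k \<nu> F \<le> choices_avg n k \<nu> G"
  unfolding choices_avg_def by (intro sum_mono mult_left_mono) auto

lemma choices_avg_add: "choices_avg n k \<nu> (\<lambda>W. F W + G W) = choices_avg n k \<nu> F + choices_avg n k \<nu> G"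
  by (simp add: choices_avg_def sum.distrib distrib_left)

lemma choices_avg_cmult: "choices_avg n k \<nu> (\<lambda>W. c * F W) = c * choices_avg n k \<nu> F"
  by (simp add: choices_avg_def sum_distrib_left mult_ac)

lemma choices_avg_sum: "choices_avg n k \<nu> (\<lambda>W. \<Sum>l\<in>I. F l W) = (\<Sum>l\<in>I. choices_avg n k \<nu> (F l))"
  unfolding choices_avg_def sum_distrib_left by (rule sum.swap)

lemma choices_avg_eq_expectation:
  assumes "sub_distribution k \<nu>"
  shows "choices_avg n k \<nu> F = measure_pmf.expectation (choices_pmf n k \<nu>) F"
  unfolding choices_avg_def
  by (subst integral_measure_pmf_real[OF finite_set_choices_pmf[OF assms]]) (auto simp: mult.commute)

lemma choices_avg_const:
  assumes "sub_distribution k \<nu>"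
  shows "choices_avg n k \<nu> (\<lambda>_. c) = c"
  by (simp add: choices_avg_eq_expectation[OF assms])

text \<open>The owner of column \<open>j\<close> is independent of the other owners, and
  \<open>F\<close> does not depend on it, so the expectation factors.\<close>

lemma choices_avg_resample:
  assumes \<nu>: "sub_distribution k \<nu>" and j: "j < n" and i: "i < k"
    and indep: "\<And>W w. F (W(j := w)) = F W"
  shows "choices_avg n k \<nu> (\<lambda>W. of_bool (W j = Some i) * F W) = \<nu> i * choices_avg n k \<nu> F"
proof -
  define p where "p = choice_pmf k \<nu>"
  define q where "q = Pi_pmf ({..<n} - {j}) None (\<lambda>_. p)"
  have fp: "finite (set_pmf p)" unfolding p_def by (rule finite_set_choice_pmf[OF \<nu>])
  have fq: "finite (set_pmf q)"
    unfolding q_def by (simp add: set_Pi_pmf finite_PiE_dflt fp)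
  have W: "choices_pmf n k \<nu> = p \<bind> (\<lambda>w. q \<bind> (\<lambda>W. return_pmf (W(j := w))))"
  proof -
    have "choices_pmf n k \<nu> = Pi_pmf (insert j ({..<n} - {j})) None (\<lambda>_. p)"
      unfolding choices_pmf_def p_def using j by (simp add: insert_absorb)
    also have "\<dots> = p \<bind> (\<lambda>w. q \<bind> (\<lambda>W. return_pmf (W(j := w))))"
      unfolding q_def by (subst Pi_pmf_insert) (simp_all add: pair_pmf_def map_bind_pmf)
    finally show ?thesis .
  qed
  have E: "measure_pmf.expectation (choices_pmf n k \<nu>) (\<lambda>W. u (W j) * F W)
     = (\<Sum>w\<in>set_pmf p. pmf p w * u w) * measure_pmf.expectation q F" for u
  proof -
    have "measure_pmf.expectation (choices_pmf n k \<nu>) (\<lambda>W. u (W j) * F W)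
      = (\<Sum>w\<in>set_pmf p. pmf p w *\<^sub>R measure_pmf.expectation (q \<bind> (\<lambda>W. return_pmf (W(j := w)))) (\<lambda>W. u (W j) * F W))"
      unfolding W using fp fq by (intro pmf_expectation_bind) auto
    also have "\<dots> = (\<Sum>w\<in>set_pmf p. pmf p w * (u w * measure_pmf.expectation q F))"
      by (simp add: map_pmf_def[symmetric] indep)
    finally show ?thesis by (simp add: sum_distrib_right mult.assoc)
  qed
  have "(\<Sum>w\<in>set_pmf p. pmf p w * 1) = 1"
    using fp by (simp add: sum_pmf_eq_1)
  then have F: "measure_pmf.expectation (choices_pmf n k \<nu>) F = measure_pmf.expectation q F"
    using E[of "\<lambda>_. 1"] by simp
  have "(\<Sum>w\<in>set_pmf p. pmf p w * of_bool (w = Some i)) = (\<Sum>w\<in>set_pmf p. if w = Some i then pmf p w else 0)"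
    by (intro sum.cong) auto
  also have "\<dots> = \<nu> i"
    using fp i by (simp add: sum.delta' sum.delta p_def pmf_choice_pmf[OF \<nu>] set_pmf_eq)
  finally show ?thesis
    unfolding choices_avg_eq_expectation[OF \<nu>] using E[of "\<lambda>w. of_bool (w = Some i)"] by (simp add: F)
qed

lemma expectation_D0:
  assumes "sub_distribution k \<nu>"
  shows "measure_pmf.expectation (D0 n k \<nu>) h
    = choices_avg n k \<nu> (\<lambda>W. subset_avg n (\<lambda>B. h (\<lambda>i j. j \<in> B \<inter> cells n W i)))"
proof -
  have fin: "finite (set_pmf (pmf_of_set (Pow {..<n}) \<bind> (\<lambda>B. return_pmf (\<lambda>i j. j \<in> B \<inter> cells n W i))))" for W
    by (simp add: Pow_not_empty)
  show ?thesis
    unfolding D0_eq choices_avg_def subset_avg_def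
    by (subst pmf_expectation_bind[OF finite_set_choices_pmf[OF assms] fin order_refl])
      (simp add: pmf_expectation_bind_pmf_of_set Pow_not_empty card_Pow sum_distrib_left divide_inverse mult_ac)
qed

lemma D0_finite:
  assumes "sub_distribution k \<nu>"
  shows "finite (set_pmf (D0 n k \<nu>))"
  unfolding D0_eq using finite_set_choices_pmf[OF assms] by (simp add: Pow_not_empty)

text \<open>The planted column \<open>jstar\<close> is independent of \<open>X\<close>, so it may be
  drawn first and averaged on the outside.\<close>

lemma expectation_D1:
  assumes \<nu>: "sub_distribution k \<nu>" and n: "n \<ge> 1"
  shows "measure_pmf.expectation (D1 n k \<nu>) h
    = (\<Sum>j<n. measure_pmf.expectation (D0 n k \<nu>) (\<lambda>X. h (\<lambda>i j'. if j' = j then i < k else X i j'))) / n"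
proof -
  have "0 \<in> {..<n}" using n by simp
  then have ne: "{..<n} \<noteq> {}" by blast
  have "D1 n k \<nu> = pmf_of_set {..<n} \<bind> (\<lambda>j. D0 n k \<nu> \<bind> (\<lambda>X. return_pmf (\<lambda>i j'. if j' = j then i < k else X i j')))"
    unfolding D1_def by (rule bind_commute_pmf)
  then have "measure_pmf.expectation (D1 n k \<nu>) h
     = (\<Sum>j<n. measure_pmf.expectation (D0 n k \<nu> \<bind> (\<lambda>X. return_pmf (\<lambda>i j'. if j' = j then i < k else X i j'))) h /\<^sub>R real (card {..<n}))"
    using ne D0_finite[OF \<nu>] by (simp only:) (intro pmf_expectation_bind_pmf_of_set, auto)
  then show ?thesis
    by (simp add: map_pmf_def[symmetric] sum_distrib_left divide_inverse mult.commute)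
qed

text \<open>The factor 2 clears the prior \<open>1/2\<close> on \<open>b\<close>, leaving false
  acceptance plus false rejection.\<close>

lemma error_eq:
  assumes \<nu>: "sub_distribution k \<nu>" and n: "n \<ge> 1"
  shows "2 * error n k \<nu> P = measure_pmf.expectation (D0 n k \<nu>) (\<lambda>X. of_bool (run P X = True) :: real)
     + (1 - measure_pmf.expectation (D1 n k \<nu>) (\<lambda>X. of_bool (run P X = True) :: real))"
proof -
  have fin1: "finite (set_pmf (D1 n k \<nu>))"
  proof -
    have "0 \<in> {..<n}" using n by simp
    then have "{..<n} \<noteq> {}" by blast
    then show ?thesis unfolding D1_def using D0_finite[OF \<nu>] by simp
  qed
  have fin: "finite (set_pmf ((if b then D1 n k \<nu> else D0 n k \<nu>) \<bind> (\<lambda>X. return_pmf (b, X))))" for b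
    using fin1 D0_finite[OF \<nu>] by simp
  define h where "h = (\<lambda>(b, X). if b then 1 - of_bool (run P X = True) else of_bool (run P X = True) :: real)"
  have "h = indicator {(b, X). run P X \<noteq> b}"
    by (auto simp: h_def indicator_def fun_eq_iff)
  then have "error n k \<nu> P = measure_pmf.expectation (D n k \<nu>) h"
    by (simp add: error_def)
  also have "\<dots> = (\<Sum>b\<in>UNIV. pmf (bernoulli_pmf (1/2)) b *\<^sub>R measure_pmf.expectation
      ((if b then D1 n k \<nu> else D0 n k \<nu>) \<bind> (\<lambda>X. return_pmf (b, X))) h)"
    unfolding D_def using fin by (intro pmf_expectation_bind) auto
  also have "\<dots> = (measure_pmf.expectation (D0 n k \<nu>) (\<lambda>X. of_bool (run P X = True) :: real)
     + measure_pmf.expectation (D1 n k \<nu>) (\<lambda>X. 1 - of_bool (run P X = True) :: real)) / 2"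
    by (simp add: UNIV_bool map_pmf_def[symmetric] add_divide_distrib h_def)
  also have "measure_pmf.expectation (D1 n k \<nu>) (\<lambda>X. 1 - of_bool (run P X = True) :: real)
     = 1 - measure_pmf.expectation (D1 n k \<nu>) (\<lambda>X. of_bool (run P X = True) :: real)"
    using integrable_measure_pmf_finite[OF fin1, of "\<lambda>X. of_bool (run P X = True)"]
    by (subst Bochner_Integration.integral_diff) (auto simp: integrable_measure_pmf_finite[OF fin1])
  finally show ?thesis by simp
qed

section \<open>Acceptance on all-zero versus all-one columns, and the final count\<close>

lemma cells_disjoint: "i \<noteq> i' \<Longrightarrow> cells n W i \<inter> cells n W i' = {}"
  by (auto simp: cells_def)

text \<open>Acceptance is expanded over leaves; for each leaf the players read disjoint parts of
  \<open>B\<close>, so the average factors. \<open>T\<close> holds the planted column, if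
  any.\<close>

lemma subset_avg_accept:
  assumes sp: "speakers P \<subseteq> {..<k}"
    and disj: "\<And>i i'. i < k \<Longrightarrow> i' < k \<Longrightarrow> i \<noteq> i' \<Longrightarrow> S i \<inter> S i' = {}"
    and X: "\<And>B i. i < k \<Longrightarrow> X B i = (\<lambda>x. x \<in> T \<union> B \<inter> S i)"
  shows "subset_avg n (\<lambda>B. of_bool (run P (X B) = b))
    = (\<Sum>\<pi>\<in>{\<pi>\<in>paths P. leaf_out P \<pi> = b}. \<Prod>i<k. mass n T (S i) (rect P \<pi> i))"
proof -
  have "subset_avg n (\<lambda>B. of_bool (run P (X B) = b))
    = subset_avg n (\<lambda>B. \<Sum>\<pi>\<in>{\<pi>\<in>paths P. leaf_out P \<pi> = b}. \<Prod>i<k. of_bool ((\<lambda>x. x \<in> T \<union> B \<inter> S i) \<in> rect P \<pi> i))"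
    unfolding of_bool_run_eq_sum_paths[OF sp] using X by (intro subset_avg_cong sum.cong prod.cong refl) simp
  then show ?thesis
    unfolding subset_avg_sum mass_def
    using subset_avg_prod_disjoint[where g = "\<lambda>i A. of_bool ((\<lambda>x. x \<in> T \<union> A) \<in> rect P \<pi> i)" for \<pi>, OF disj] by simp
qed

text \<open>A mixture of two normalized additive set functions is again one, so the leaf products of
  every interpolation sum to 1, as the event gap bound demands.\<close>

lemma accept_gap:
  assumes sp: "speakers P \<subseteq> {..<k}" and Q: "Q \<subseteq> paths P"
  shows "(\<Sum>\<pi>\<in>Q. \<Prod>i<k. mass n {j} (S i - {j}) (rect P \<pi> i))
     - (\<Sum>\<pi>\<in>Q. \<Prod>i<k. mass n {} (S i - {j}) (rect P \<pi> i))
    \<le> 1/4 + 16 * (\<Sum>i<k. coordinate_discrepancy n k P S i j)"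
  unfolding coordinate_discrepancy_def
proof (rule product_measures_event_gap[OF mass_nonneg mass_nonneg _ finite_paths Q])
  fix p :: real
  show "(\<Sum>\<pi>\<in>paths P. \<Prod>i<k. (1 - p) * mass n {} (S i - {j}) (rect P \<pi> i) + p * mass n {j} (S i - {j}) (rect P \<pi> i)) = 1"
  proof (rule sum_paths_prod_additive[where v = "\<lambda>i R. (1 - p) * mass n {} (S i - {j}) R + p * mass n {j} (S i - {j}) R", OF sp])
    fix i A E
    show "(1 - p) * mass n {} (S i - {j}) A + p * mass n {j} (S i - {j}) A
      = (1 - p) * mass n {} (S i - {j}) (A \<inter> E) + p * mass n {j} (S i - {j}) (A \<inter> E)
      + ((1 - p) * mass n {} (S i - {j}) (A \<inter> - E) + p * mass n {j} (S i - {j}) (A \<inter> - E))"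
      unfolding mass_additive[of n _ _ A E] by (simp add: algebra_simps)
  qed (simp add: mass_UNIV)
qed

text \<open>Whichever player owns column \<open>j\<close>, the column is zero with probability at least 1/2.\<close>

lemma prod_mass_erase_le:
  fixes k :: nat
  assumes "\<And>i i'. i < k \<Longrightarrow> i' < k \<Longrightarrow> i \<noteq> i' \<Longrightarrow> S i \<inter> S i' = {}" and j: "j < n"
  shows "(\<Prod>i<k. mass n {} (S i - {j}) (R i)) \<le> 2 * (\<Prod>i<k. mass n {} (S i) (R i))"
proof (cases "\<exists>i<k. j \<in> S i")
  case True
  then obtain i where i: "i < k" "j \<in> S i" by blast
  have "(\<Prod>i'\<in>{..<k}-{i}. mass n {} (S i' - {j}) (R i')) = (\<Prod>i'\<in>{..<k}-{i}. mass n {} (S i') (R i'))"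
  proof (intro prod.cong refl)
    fix i' assume "i' \<in> {..<k} - {i}"
    then have "S i' - {j} = S i'" using assms(1)[of i i'] i by auto
    then show "mass n {} (S i' - {j}) (R i') = mass n {} (S i') (R i')" by simp
  qed
  moreover have "mass n {} (S i - {j}) (R i) \<le> 2 * mass n {} (S i) (R i)"
    unfolding mass_split(1)[OF i(2) j] using mass_nonneg[of n "{j}"] by simp
  ultimately show ?thesis
    using i mult_right_mono[OF \<open>mass n {} (S i - {j}) (R i) \<le> 2 * mass n {} (S i) (R i)\<close>,
        of "\<Prod>i'\<in>{..<k}-{i}. mass n {} (S i') (R i')"]
    by (simp add: prod.remove[of "{..<k}" i] prod_nonneg mass_nonneg mult.assoc)
next
  case False
  then have "(\<Prod>i<k. mass n {} (S i - {j}) (R i)) = (\<Prod>i<k. mass n {} (S i) (R i))"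
    by (intro prod.cong) auto
  moreover have "(\<Prod>i<k. mass n {} (S i) (R i)) \<ge> 0" by (intro prod_nonneg) (simp add: mass_nonneg)
  ultimately show ?thesis by simp
qed

text \<open>The discrepancy at \<open>j\<close> erases \<open>j\<close> from every cell, so it is
  independent of who owns \<open>j\<close>. Restricting to columns owned by \<open>i\<close>
  therefore costs exactly \<open>\<nu> i\<close>, and the restricted sum is at most
  \<open>6 * c i\<close> for each \<open>W\<close>.\<close>

lemma sum_choices_avg_discrepancy_le:
  assumes \<nu>: "sub_distribution k \<nu>" and P: "bounded_protocol k c P" and i: "i < k"
    and zero: "\<nu> i = 0 \<Longrightarrow> c i = 0"
  shows "(\<Sum>j<n. choices_avg n k \<nu> (\<lambda>W. coordinate_discrepancy n k P (cells n W) i j)) \<le> 6 * (c i / \<nu> i)"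
proof -
  define F where "F j W = coordinate_discrepancy n k P (cells n W) i j" for j W
  have F_indep: "F j (W(j := w)) = F j W" for j W w
  proof -
    have "cells n (W(j := w)) i' - {j} = cells n W i' - {j}" for i'
      by (auto simp: cells_def)
    then show ?thesis by (simp add: F_def coordinate_discrepancy_def)
  qed
  have total: "(\<Sum>j<n. of_bool (W j = Some i) * F j W) \<le> 6 * c i" for W
  proof -
    have "(\<Sum>j<n. of_bool (W j = Some i) * F j W) = (\<Sum>j\<in>cells n W i. F j W)"
      by (rule sum.mono_neutral_cong_right) (auto simp: cells_def)
    also have "\<dots> \<le> 6 * c i"
      unfolding F_def using cells_disjoint
      by (intro sum_coordinate_discrepancy_le[OF P i]) (auto simp: cells_def)
    finally show ?thesis .
  qed
  have F_nonneg: "0 \<le> F j W" for j W by (simp add: F_def coordinate_discrepancy_nonneg)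
  show ?thesis
  proof (cases "\<nu> i = 0")
    case True
    \<comment> \<open>The bound holds pointwise, so it also applies to the null event that \<open>i\<close> owns column \<open>j\<close>.\<close>
    have "F j W = 0" if j: "j < n" for j W
    proof -
      have "F j W = of_bool ((W(j := Some i)) j = Some i) * F j (W(j := Some i))"
        by (simp add: F_indep)
      also have "\<dots> \<le> (\<Sum>j'<n. of_bool ((W(j := Some i)) j' = Some i) * F j' (W(j := Some i)))"
        using j F_nonneg by (intro member_le_sum) auto
      also have "\<dots> \<le> 0"
        using total[of "W(j := Some i)"] zero[OF True] by simp
      finally show ?thesis using F_nonneg[of j W] by simp
    qed
    then have "(\<Sum>j<n. choices_avg n k \<nu> (F j)) = 0" by (simp add: choices_avg_def)
    then show ?thesis using True by (simp add: F_def[abs_def])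
  next
    case False
    then have pos: "\<nu> i > 0" using \<nu> i by (auto simp: sub_distribution_def less_le)
    have "\<nu> i * (\<Sum>j<n. choices_avg n k \<nu> (F j)) = choices_avg n k \<nu> (\<lambda>W. \<Sum>j<n. of_bool (W j = Some i) * F j W)"
      unfolding choices_avg_sum sum_distrib_left
      by (intro sum.cong refl choices_avg_resample[symmetric] \<nu> i F_indep) simp
    also have "\<dots> \<le> choices_avg n k \<nu> (\<lambda>_. 6 * c i)"
      by (intro choices_avg_mono total)
    finally show ?thesis
      using pos by (simp add: choices_avg_const[OF \<nu>] F_def[abs_def] field_simps)
  qed
qed

lemma sum_cost_ratio_ge:
  assumes n: "n \<ge> 1" and \<nu>: "sub_distribution k \<nu>" and P: "bounded_protocol k c P"
    and err: "error n k \<nu> P \<le> 2/100" and zero: "\<And>i. i < k \<Longrightarrow> \<nu> i = 0 \<Longrightarrow> c i = 0"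
  shows "real n / 200 \<le> (\<Sum>i<k. c i / \<nu> i)"
proof -
  define Q where "Q = {\<pi>\<in>paths P. leaf_out P \<pi> = True}"
  define S where "S = cells n"
  \<comment> \<open>Given \<open>W\<close>, these are acceptance probabilities:
    \<open>\<alpha>\<close> for the unmodified input, \<open>\<beta>0\<close> with column
    \<open>j\<close> erased, \<open>\<beta>1\<close> with column \<open>j\<close> filled with
    ones.\<close>
  define \<alpha> where "\<alpha> W = (\<Sum>\<pi>\<in>Q. \<Prod>i<k. mass n {} (S W i) (rect P \<pi> i))" for W
  define \<beta>0 where "\<beta>0 j W = (\<Sum>\<pi>\<in>Q. \<Prod>i<k. mass n {} (S W i - {j}) (rect P \<pi> i))" for j W
  define \<beta>1 where "\<beta>1 j W = (\<Sum>\<pi>\<in>Q. \<Prod>i<k. mass n {j} (S W i - {j}) (rect P \<pi> i))" for j W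
  define \<delta> where "\<delta> i j W = coordinate_discrepancy n k P (S W) i j" for i j W
  have sp: "speakers P \<subseteq> {..<k}" using P by (simp add: bounded_protocol_def)
  have disj: "S W i \<inter> S W i' = {}" if "i \<noteq> i'" for W i i'
    using that by (simp add: S_def cells_disjoint)
  let ?E0 = "measure_pmf.expectation (D0 n k \<nu>) (\<lambda>X. of_bool (run P X = True) :: real)"
  let ?E1 = "measure_pmf.expectation (D1 n k \<nu>) (\<lambda>X. of_bool (run P X = True) :: real)"
  have E0: "?E0 = choices_avg n k \<nu> \<alpha>"
  proof -
    have "subset_avg n (\<lambda>B. of_bool (run P (\<lambda>i j. j \<in> B \<inter> S W i) = True)) = \<alpha> W" for W
      unfolding \<alpha>_def Q_def using disj by (intro subset_avg_accept[OF sp]) auto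
    then show ?thesis unfolding expectation_D0[OF \<nu>] S_def[symmetric] by simp
  qed
  have E1: "n * ?E1 = (\<Sum>j<n. choices_avg n k \<nu> (\<beta>1 j))"
  proof -
    have "n * ?E1 = (\<Sum>j<n. measure_pmf.expectation (D0 n k \<nu>)
       (\<lambda>X. of_bool (run P (\<lambda>i j'. if j' = j then i < k else X i j') = True)))"
      unfolding expectation_D1[OF \<nu> n] using n by simp
    also have "\<dots> = (\<Sum>j<n. choices_avg n k \<nu> (\<beta>1 j))"
    proof (rule sum.cong[OF refl])
      fix j
      have "subset_avg n (\<lambda>B. of_bool (run P (\<lambda>i j'. if j' = j then i < k else j' \<in> B \<inter> S W i) = True)) = \<beta>1 j W" for W
        unfolding \<beta>1_def Q_def using disj by (intro subset_avg_accept[OF sp]) auto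
      then show "measure_pmf.expectation (D0 n k \<nu>)
         (\<lambda>X. of_bool (run P (\<lambda>i j'. if j' = j then i < k else X i j') = True)) = choices_avg n k \<nu> (\<beta>1 j)"
        unfolding expectation_D0[OF \<nu>] S_def[symmetric] by simp
    qed
    finally show ?thesis .
  qed
  \<comment> \<open>Erasing column \<open>j\<close> bridges the two input distributions: it at most
    doubles acceptance under \<open>D0\<close>, and the discrepancies bound the step from zeros to
    ones.\<close>
  have *: "\<beta>1 j W \<le> 2 * \<alpha> W + (1/4 + 16 * (\<Sum>i<k. \<delta> i j W))" if "j < n" for j W
  proof -
    have "\<beta>0 j W \<le> 2 * \<alpha> W"
      unfolding \<beta>0_def \<alpha>_def sum_distrib_left using disj that by (intro sum_mono prod_mass_erase_le) auto
    moreover have "\<beta>1 j W - \<beta>0 j W \<le> 1/4 + 16 * (\<Sum>i<k. \<delta> i j W)"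
      unfolding \<beta>1_def \<beta>0_def \<delta>_def by (rule accept_gap[OF sp]) (simp add: Q_def)
    ultimately show ?thesis by simp
  qed
  have "n * ?E1 \<le> (\<Sum>j<n. choices_avg n k \<nu> (\<lambda>W. 2 * \<alpha> W + (1/4 + 16 * (\<Sum>i<k. \<delta> i j W))))"
    unfolding E1 by (intro sum_mono choices_avg_mono *) simp
  also have "\<dots> = n * (2 * ?E0 + 1/4) + 16 * (\<Sum>i<k. \<Sum>j<n. choices_avg n k \<nu> (\<delta> i j))"
    unfolding choices_avg_add choices_avg_cmult choices_avg_const[OF \<nu>] choices_avg_sum E0
    by (subst sum.swap[of _ "{..<n}"]) (simp add: sum.distrib sum_distrib_left[symmetric] algebra_simps)
  also have "(\<Sum>i<k. \<Sum>j<n. choices_avg n k \<nu> (\<delta> i j)) \<le> (\<Sum>i<k. 6 * (c i / \<nu> i))"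
    unfolding \<delta>_def S_def by (intro sum_mono sum_choices_avg_discrepancy_le[OF \<nu> P]) (auto intro: zero)
  also have "\<dots> = 6 * (\<Sum>i<k. c i / \<nu> i)" by (simp add: sum_distrib_left)
  finally have main: "n * ?E1 \<le> n * (2 * ?E0 + 1/4) + 96 * (\<Sum>i<k. c i / \<nu> i)" by simp
  have E0: "?E0 + (1 - ?E1) \<le> 4/100"
    using error_eq[OF \<nu> n, of P] err by simp
  have E1_le: "?E1 \<le> 1" and E0_nonneg: "0 \<le> ?E0"
    by (auto intro!: Bochner_Integration.integral_nonneg measure_pmf.integral_le_const measure_pmf.integrable_const_bound[where B = 1])
  \<comment> \<open>The error bound gives \<open>?E1 \<ge> 96/100 + ?E0\<close> and
    \<open>?E0 \<le> 4/100\<close>, so the bracket is at least \<open>67/100\<close>. Dividing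
    \<open>6/10\<close> by 96 gives \<open>1/160\<close>, which exceeds
    \<open>1/200\<close>.\<close>
  have "n * (6/10) \<le> n * (?E1 - 2 * ?E0 - 1/4)"
    using E0 E1_le E0_nonneg by (intro mult_left_mono) auto
  then show ?thesis using main by (simp add: algebra_simps)
qed

theorem mainTheorem7:
  "\<exists>C::real. C > 0 \<and>
    (\<forall>n k \<nu> c P. n \<ge> 1 \<longrightarrow> k \<ge> 2 \<longrightarrow> sub_distribution k \<nu> \<longrightarrow>
       bounded_protocol k c P \<longrightarrow> error n k \<nu> P \<le> 2/100 \<longrightarrow>
       (\<Sum>i<k. ratio (c i) (\<nu> i)) \<ge> ennreal (C * real n))"
proof (intro exI conjI allI impI)
  show "(1/200 :: real) > 0" by simp
next
  fix n k :: nat and \<nu> c P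
  assume n: "n \<ge> 1" and \<nu>: "sub_distribution k \<nu>" and P: "bounded_protocol k c P"
    and err: "error n k \<nu> P \<le> 2/100"
  show "(\<Sum>i<k. ratio (c i) (\<nu> i)) \<ge> ennreal (1/200 * real n)"
  proof (cases "\<exists>i<k. \<nu> i = 0 \<and> c i \<noteq> 0")
    case True
    then obtain i where i: "i < k" "\<nu> i = 0" "c i \<noteq> 0" by blast
    then have "ratio (c i) (\<nu> i) \<le> (\<Sum>i<k. ratio (c i) (\<nu> i))"
      by (intro member_le_sum) auto
    moreover have "ratio (c i) (\<nu> i) = \<infinity>" using i by (simp add: ratio_def)
    ultimately show ?thesis by (metis infinity_ennreal_def top_greatest order_trans)
  next
    case False
    \<comment> \<open>A vanishing \<open>\<nu> i\<close> now forces \<open>c i = 0\<close>, where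
      real division by zero also yields 0 and agrees with the convention.\<close>
    then have "ratio (c i) (\<nu> i) = ennreal (c i / \<nu> i)" if "i < k" for i
      using that by (auto simp: ratio_def)
    then have "(\<Sum>i<k. ratio (c i) (\<nu> i)) = (\<Sum>i<k. ennreal (c i / \<nu> i))"
      by (intro sum.cong) auto
    also have "\<dots> = ennreal (\<Sum>i<k. c i / \<nu> i)"
      using \<nu> by (intro sum_ennreal) (auto simp: sub_distribution_def)
    finally show ?thesis
      using sum_cost_ratio_ge[OF n \<nu> P err] False by (auto intro!: ennreal_leI)
  qed
qed

end
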